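(* Let $\beta>0$. Let $m,n\to\infty$ (with $n=n_m$ and $P=P_m$ depending on $m$) so that $mn^{-1}\to\beta$. Let $X_1$ have distribution $P$. Assume that $X_1$ converges in distribution to a random variable $Z$ with $\mathbf E Z^3<\infty$ and $\mathbf P(Z\ge2)>0$, and that $\lim_{m\to\infty}\mathbf E X_1^3=\mathbf E Z^3$. Let $\tilde Z_1,\tilde Z_2,\dots$ be independent random variables with common distribution $\tilde P_Z$, let $\Lambda$ be independent of this sequence with Poisson distribution of mean $\beta^{-1}\mathbf E Z$, and put $$d_*=\sum_{j=1}^{\Lambda}\tilde Z_j,\qquad d_{2*}=\sum_{j=1}^{\Lambda}(\tilde Z_j)_2.$$ Then for every $k=2,3,\dots$ satisfying $\mathbf P(d_*=k)>0$ we have, as $m,n\to\infty$, $$\alpha^{*[k]}(n,m,P)=\frac1{k(k-1)}\,\mathbf E\bigl(d_{2*}\mid d_*=k\bigr)+o(1).$$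
   Context: Passive random intersection graph $G^*_1(n,m,P)$: let $W=\{w_1,\dots,w_m\}$ and let $P$ be a probability distribution on $\{0,1,\dots,m\}$. Let $D_1,\dots,D_n$ be independent identically distributed random subsets of $W$ with $\mathbf P(D_i=A)=P(|A|)\binom{m}{|A|}^{-1}$ for each $A\subset W$; write $X_i=|D_i|$, so $X_i$ has distribution $P$. The vertex set is $W$; distinct $w,w'\in W$ are adjacent ($w\sim w'$) iff $\{w,w'\}\subset D_j$ for at least one $j$. Let $d(w_1)$ be the degree of $w_1$. For an integer $k\ge2$, $\alpha^{*[k]}(n,m,P)=\mathbf P\bigl(w_2\sim w_3\mid w_1\sim w_2,\ w_1\sim w_3,\ d(w_1)=k\bigr)$. Notation: $(x)_2=x(x-1)$. For a random variable $Z$ with values in $\{0,1,2,\dots\}$ and $0<\mathbf E Z<\infty$, the distribution $\tilde P_Z$ on $\{0,1,2,\dots\}$ puts mass $(j+1)\mathbf P(Z=j+1)/\mathbf E Z$ on $j=0,1,2,\dots$. *)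

theory Defs
  imports "HOL-Probability.Probability" "HOL-Probability.Product_PMF"
begin

text \<open>
  The attribute set \<open>W = {w_1, \<dots>, w_m}\<close> is \<open>{1..m}\<close>, with \<open>w_i\<close> represented by \<open>i\<close>.
\<close>

definition random_subset_pmf :: "nat \<Rightarrow> nat pmf \<Rightarrow> nat set pmf" where
  "random_subset_pmf m P =
     embed_pmf (\<lambda>A. if A \<subseteq> {1..m} then pmf P (card A) / real (m choose card A) else 0)"

text \<open>
  For \<open>P\<close> supported in \<open>{0..m}\<close> the weights above sum to one, so that \<^const>\<open>embed_pmf\<close> is
  meaningful.
\<close>

lemma pmf_random_subset:
  assumes "set_pmf P \<subseteq> {..m}"
  shows "pmf (random_subset_pmf m P) A =
    (if A \<subseteq> {1..m} then pmf P (card A) / real (m choose card A) else 0)"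
proof -
  let ?f = "\<lambda>A. if A \<subseteq> {1..m} then pmf P (card A) / real (m choose card A) else (0::real)"
  have fib: "(\<Sum>A\<in>{A \<in> Pow {1..m}. card A = j}. ?f A) = pmf P j" if "j \<in> {..m}" for j
  proof -
    have "(\<Sum>A\<in>{A \<in> Pow {1..m}. card A = j}. ?f A)
        = (\<Sum>A\<in>{A. A \<subseteq> {1..m} \<and> card A = j}. pmf P j / real (m choose j))"
      by (rule sum.cong) auto
    also have "\<dots> = real (m choose j) * (pmf P j / real (m choose j))"
      using n_subsets[of "{1..m}" j] by simp
    also have "\<dots> = pmf P j"
      using that by simp
    finally show ?thesis .
  qed
  have card: "card ` Pow {1..m} \<subseteq> {..m}"
    using card_mono[of "{1..m}"] by auto
  have "(\<Sum>A\<in>Pow {1..m}. ?f A) = (\<Sum>j\<le>m. \<Sum>A\<in>{A \<in> Pow {1..m}. card A = j}. ?f A)"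
    using card by (subst sum.group) auto
  also have "\<dots> = (\<Sum>j\<le>m. pmf P j)"
    using fib by (intro sum.cong) auto
  also have "\<dots> = 1"
    using sum_pmf_eq_1[OF _ assms] by simp
  finally have total: "(\<Sum>A\<in>Pow {1..m}. ?f A) = 1" .
  have "(\<integral>\<^sup>+A. ennreal (?f A) \<partial>count_space UNIV) = (\<Sum>A\<in>Pow {1..m}. ennreal (?f A))"
    by (rule nn_integral_count_space'[of "Pow {1..m}"]) auto
  also have "\<dots> = ennreal (\<Sum>A\<in>Pow {1..m}. ?f A)"
    by (rule sum_ennreal) auto
  finally have "(\<integral>\<^sup>+A. ennreal (?f A) \<partial>count_space UNIV) = 1"
    by (simp only: total ennreal_1)
  then show ?thesis
    unfolding random_subset_pmf_def by (subst pmf_embed_pmf) auto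
qed

text \<open>The joint law of \<open>(D_1, \<dots>, D_n)\<close>; values outside \<open>{1..n}\<close> are a dummy.\<close>

definition passive_rig :: "nat \<Rightarrow> nat \<Rightarrow> nat pmf \<Rightarrow> (nat \<Rightarrow> nat set) pmf" where
  "passive_rig n m P = Pi_pmf {1..n} {} (\<lambda>_. random_subset_pmf m P)"

definition adj :: "nat \<Rightarrow> (nat \<Rightarrow> nat set) \<Rightarrow> nat \<Rightarrow> nat \<Rightarrow> bool" where
  "adj n D w w' \<longleftrightarrow> w \<noteq> w' \<and> (\<exists>j\<in>{1..n}. {w, w'} \<subseteq> D j)"

definition deg :: "nat \<Rightarrow> nat \<Rightarrow> (nat \<Rightarrow> nat set) \<Rightarrow> nat \<Rightarrow> nat" where
  "deg n m D w = card {w' \<in> {1..m}. adj n D w w'}"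

definition alpha_star :: "nat \<Rightarrow> nat \<Rightarrow> nat \<Rightarrow> nat pmf \<Rightarrow> real" where
  "alpha_star k n m P =
     \<P>(D in measure_pmf (passive_rig n m P).
        adj n D 2 3 \<bar> adj n D 1 2 \<and> adj n D 1 3 \<and> deg n m D 1 = k)"

text \<open>The mass function of the law written \<open>P\<close>-tilde with subscript \<open>Z\<close>.\<close>

definition size_biased_mass :: "'a measure \<Rightarrow> ('a \<Rightarrow> nat) \<Rightarrow> nat \<Rightarrow> real" where
  "size_biased_mass N Z j =
     real (j + 1) * \<P>(\<omega> in N. Z \<omega> = j + 1) / (\<integral>\<omega>. real (Z \<omega>) \<partial>N)"

definition d_star :: "('a \<Rightarrow> nat) \<Rightarrow> (nat \<Rightarrow> 'a \<Rightarrow> nat) \<Rightarrow> 'a \<Rightarrow> nat" where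
  "d_star \<Lambda> Zt \<omega> = (\<Sum>j = 1..\<Lambda> \<omega>. Zt j \<omega>)"

definition d2_star :: "('a \<Rightarrow> nat) \<Rightarrow> (nat \<Rightarrow> 'a \<Rightarrow> nat) \<Rightarrow> 'a \<Rightarrow> real" where
  "d2_star \<Lambda> Zt \<omega> = (\<Sum>j = 1..\<Lambda> \<omega>. real (Zt j \<omega>) * (real (Zt j \<omega>) - 1))"

text \<open>Elementary conditional expectation given an event of positive probability.\<close>

definition event_cond_exp :: "'a measure \<Rightarrow> ('a \<Rightarrow> real) \<Rightarrow> ('a \<Rightarrow> bool) \<Rightarrow> real" where
  "event_cond_exp M f Q =
     (\<integral>\<omega>. f \<omega> * indicator {\<omega> \<in> space M. Q \<omega>} \<omega> \<partial>M) / \<P>(\<omega> in M. Q \<omega>)"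

end

theory Submission
  imports Defs "HOL-Computational_Algebra.Formal_Power_Series"
begin

text \<open>
  By symmetry under permutations of the attributes fixing \<open>w_1\<close>, the conditional probability equals
  \<open>E[T; d(w_1) = k] / (k (k - 1) P(d(w_1) = k))\<close>, where \<open>T\<close> counts the ordered adjacent pairs of
  neighbours of \<open>w_1\<close>.  Put \<open>Y_j = |D_j| - 1\<close> if \<open>w_1\<close> lies in \<open>D_j\<close> and \<open>Y_j = 0\<close> otherwise.
  Unless two of the sets \<open>D_j - {w_1}\<close> with \<open>w_1\<close> in \<open>D_j\<close> meet, or some \<open>D_i\<close> creates an edge
  between neighbours of \<open>w_1\<close> obtained from other sets, \<open>d(w_1)\<close> is the sum of the \<open>Y_j\<close> and \<open>T\<close> is
  the sum of the \<open>(Y_j)_2\<close>; these exceptions have probability \<open>O(1/m)\<close> by the union bound.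

  The \<open>Y_j\<close> are i.i.d., so with \<open>Q\<close> the generating function of their law,
  \<open>P(\<Sum> Y_j = l)\<close> is the \<open>l\<close>-th coefficient of \<open>Q^n\<close>, and \<open>E[\<Sum> g(Y_j); \<Sum> Y_j = l]\<close> is
  \<open>n \<Sum>_i g(i) Q_i [Q^(n-1)]_(l-i)\<close>.  For \<open>g = id\<close> this is Panjer's recursion.  The compound Poisson
  sum \<open>d_*\<close> obeys the limiting recursion with \<open>\<lambda> P(Z~ = i)\<close> in place of \<open>n Q_i\<close>, and
  \<open>n Q_i \<rightarrow> \<lambda> P(Z~ = i)\<close> for \<open>i \<ge> 1\<close>, so the limits follow by induction on \<open>l\<close>.
\<close>

section \<open>Sums of independent variables and powers of generating functions\<close>

text \<open>The event \<open>A\<close> and the factor \<open>c\<close> make the induction go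
  through: fixing one variable at \<open>i\<close> shrinks \<open>A\<close> and multiplies
  \<open>c\<close> by the \<open>i\<close>-th coefficient of \<open>Q\<close>, and summing over
  \<open>i\<close> is a Cauchy product. They also allow a restriction to a given number of summands,
  with \<open>c\<close> a Poisson weight.\<close>

lemma (in prob_space) prob_sum_eq_fps_power:
  fixes Y :: "'i \<Rightarrow> 'a \<Rightarrow> nat" and Q :: "real fps"
  assumes "finite I"
    and [measurable]: "\<And>j. j \<in> I \<Longrightarrow> Y j \<in> measurable M (count_space UNIV)"
    and [measurable]: "A \<in> events"
    and "\<And>y. prob (A \<inter> {\<omega> \<in> space M. \<forall>j\<in>I. Y j \<omega> = y j}) = c * (\<Prod>j\<in>I. fps_nth Q (y j))"
  shows "prob (A \<inter> {\<omega> \<in> space M. (\<Sum>j\<in>I. Y j \<omega>) = l}) = c * fps_nth (Q ^ card I) l"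
  using assms
proof (induction I arbitrary: A c l rule: finite_induct)
  case empty
  have "A \<inter> space M = A"
    using sets.sets_into_space[OF empty(2)] by auto
  then show ?case
    using empty(3) by (cases "l = 0") auto
next
  case (insert x I)
  note [measurable] = insert.prems(1,2)
  have IH: "prob ((A \<inter> {\<omega> \<in> space M. Y x \<omega> = i}) \<inter> {\<omega> \<in> space M. (\<Sum>j\<in>I. Y j \<omega>) = l'})
      = (c * fps_nth Q i) * fps_nth (Q ^ card I) l'" for i l'
  proof (rule insert.IH)
    show "A \<inter> {\<omega> \<in> space M. Y x \<omega> = i} \<in> events"
      by measurable auto
    fix y :: "'i \<Rightarrow> nat"
    have "(A \<inter> {\<omega> \<in> space M. Y x \<omega> = i}) \<inter> {\<omega> \<in> space M. \<forall>j\<in>I. Y j \<omega> = y j}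
        = A \<inter> {\<omega> \<in> space M. \<forall>j\<in>insert x I. Y j \<omega> = (y(x := i)) j}"
      using insert.hyps(2) by auto
    moreover have eq: "(\<Prod>j\<in>I. fps_nth Q ((y(x := i)) j)) = (\<Prod>j\<in>I. fps_nth Q (y j))"
      using insert.hyps(2) by (intro prod.cong) auto
    ultimately show "prob ((A \<inter> {\<omega> \<in> space M. Y x \<omega> = i}) \<inter> {\<omega> \<in> space M. \<forall>j\<in>I. Y j \<omega> = y j})
        = (c * fps_nth Q i) * (\<Prod>j\<in>I. fps_nth Q (y j))"
      using insert.hyps insert.prems(3)[of "y(x := i)"] eq by simp
  qed (use insert.prems in auto)
  \<comment> \<open>Split by the value of \<open>Y x\<close>. The values are natural numbers, so
    \<open>i\<close> is at most \<open>l\<close> and \<open>l - i\<close> is a genuine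
    difference.\<close>
  have "A \<inter> {\<omega> \<in> space M. (\<Sum>j\<in>insert x I. Y j \<omega>) = l}
      = (\<Union>i\<in>{0..l}. (A \<inter> {\<omega> \<in> space M. Y x \<omega> = i}) \<inter> {\<omega> \<in> space M. (\<Sum>j\<in>I. Y j \<omega>) = l - i})"
    using insert.hyps by auto
  also have "prob \<dots> = (\<Sum>i=0..l. prob ((A \<inter> {\<omega> \<in> space M. Y x \<omega> = i})
      \<inter> {\<omega> \<in> space M. (\<Sum>j\<in>I. Y j \<omega>) = l - i}))"
  proof (rule finite_measure_finite_Union)
    show "(\<lambda>i. (A \<inter> {\<omega> \<in> space M. Y x \<omega> = i}) \<inter> {\<omega> \<in> space M. (\<Sum>j\<in>I. Y j \<omega>) = l - i}) ` {0..l}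
      \<subseteq> events"
      using insert.hyps(1) by auto
  qed (auto simp: disjoint_family_on_def)
  also have "\<dots> = c * fps_nth (Q ^ card (insert x I)) l"
    using insert.hyps by (simp add: IH fps_mult_nth sum_distrib_left mult.assoc)
  finally show ?case .
qed

text \<open>Once \<open>Y x = i\<close>, the other variables must add up to \<open>l - i\<close>;
  the previous lemma gives this probability, with one factor \<open>Q\<close> fewer in the
  power.\<close>

lemma (in prob_space) expectation_weighted_sum_eq:
  fixes Y :: "'i \<Rightarrow> 'a \<Rightarrow> nat" and Q :: "real fps" and g :: "nat \<Rightarrow> real"
  assumes I: "finite I" "x \<in> I"
    and Y[measurable]: "\<And>j. j \<in> I \<Longrightarrow> Y j \<in> measurable M (count_space UNIV)"
    and A[measurable]: "A \<in> events"
    and P: "\<And>y. prob (A \<inter> {\<omega> \<in> space M. \<forall>j\<in>I. Y j \<omega> = y j}) = c * (\<Prod>j\<in>I. fps_nth Q (y j))"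
  shows "expectation (\<lambda>\<omega>. g (Y x \<omega>) * indicator (A \<inter> {\<omega> \<in> space M. (\<Sum>j\<in>I. Y j \<omega>) = l}) \<omega>)
      = c * (\<Sum>i\<le>l. g i * fps_nth Q i * fps_nth (Q ^ (card I - 1)) (l - i))"
proof -
  define J where "J = I - {x}"
  have J: "finite J" "x \<notin> J" "I = insert x J" "card I - 1 = card J"
    using I by (auto simp: J_def)
  define B where "B i = (A \<inter> {\<omega> \<in> space M. Y x \<omega> = i}) \<inter> {\<omega> \<in> space M. (\<Sum>j\<in>J. Y j \<omega>) = l - i}" for i
  have Yx[measurable]: "Y x \<in> measurable M (count_space UNIV)"
    using I by auto
  have YJ[measurable]: "j \<in> J \<Longrightarrow> Y j \<in> measurable M (count_space UNIV)" for j
    using J by auto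
  have B_events: "B i \<in> events" for i
    unfolding B_def by measurable
  have prob_B: "prob (B i) = (c * fps_nth Q i) * fps_nth (Q ^ card J) (l - i)" for i
    unfolding B_def
  proof (rule prob_sum_eq_fps_power)
    fix y :: "'i \<Rightarrow> nat"
    have "(A \<inter> {\<omega> \<in> space M. Y x \<omega> = i}) \<inter> {\<omega> \<in> space M. \<forall>j\<in>J. Y j \<omega> = y j}
        = A \<inter> {\<omega> \<in> space M. \<forall>j\<in>I. Y j \<omega> = (y(x := i)) j}"
      using J by auto
    moreover have "(\<Prod>j\<in>J. fps_nth Q ((y(x := i)) j)) = (\<Prod>j\<in>J. fps_nth Q (y j))"
      using J by (intro prod.cong) auto
    ultimately show "prob ((A \<inter> {\<omega> \<in> space M. Y x \<omega> = i}) \<inter> {\<omega> \<in> space M. \<forall>j\<in>J. Y j \<omega> = y j})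
        = (c * fps_nth Q i) * (\<Prod>j\<in>J. fps_nth Q (y j))"
      using J P[of "y(x := i)"] by simp
  qed (use J in auto)
  \<comment> \<open>The events \<open>B i\<close> are disjoint, and on the event considered only the
    index \<open>Y x \<omega>\<close>, which is at most \<open>l\<close>, contributes.\<close>
  have "g (Y x \<omega>) * indicator (A \<inter> {\<omega> \<in> space M. (\<Sum>j\<in>I. Y j \<omega>) = l}) \<omega>
      = (\<Sum>i\<le>l. g i * indicator (B i) \<omega>)" if "\<omega> \<in> space M" for \<omega>
  proof (cases "\<omega> \<in> A \<and> (\<Sum>j\<in>I. Y j \<omega>) = l")
    case True
    then have "(\<Sum>i\<le>l. g i * indicator (B i) \<omega>) = (\<Sum>i\<in>{Y x \<omega>}. g i * indicator (B i) \<omega>)"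
      using J by (intro sum.mono_neutral_right) (auto simp: B_def)
    moreover have "\<omega> \<in> B (Y x \<omega>)"
      using True J that by (auto simp: B_def)
    ultimately show ?thesis
      using True that by simp
  next
    case False
    then have "indicator (B i) \<omega> = (0::real)" if "i \<le> l" for i
      using J that by (auto simp: B_def indicator_def)
    then show ?thesis
      using False by (auto simp: indicator_def)
  qed
  then have "expectation (\<lambda>\<omega>. g (Y x \<omega>) * indicator (A \<inter> {\<omega> \<in> space M. (\<Sum>j\<in>I. Y j \<omega>) = l}) \<omega>)
      = expectation (\<lambda>\<omega>. \<Sum>i\<le>l. g i * indicator (B i) \<omega>)"
    by (intro Bochner_Integration.integral_cong) auto
  also have "\<dots> = (\<Sum>i\<le>l. g i * prob (B i))"
    using B_events sets.sets_into_space[OF B_events]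
    by (subst Bochner_Integration.integral_sum) (auto simp: Int_absorb2 emeasure_eq_measure)
  also have "\<dots> = c * (\<Sum>i\<le>l. g i * fps_nth Q i * fps_nth (Q ^ (card I - 1)) (l - i))"
    unfolding J(4) by (simp add: prob_B sum_distrib_left mult_ac)
  finally show ?thesis .
qed

section \<open>Convergence of powers of generating functions\<close>

text \<open>Panjer's recursion: compare coefficients in X (Q^N)' = N (X Q') Q^(N-1), where R -> X R'
  multiplies the \<open>i\<close>-th coefficient by \<open>i\<close>.\<close>

lemma fps_power_panjer:
  fixes Q :: "real fps"
  shows "real l * fps_nth (Q ^ N) l
    = real N * (\<Sum>i\<le>l. real i * fps_nth Q i * fps_nth (Q ^ (N - 1)) (l - i))"
proof -
  have "fps_X * fps_deriv (Q ^ N) = fps_const (real N) * ((fps_X * fps_deriv Q) * Q ^ (N - 1))"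
    by (simp add: fps_deriv_power mult_ac)
  then have "fps_nth (fps_X * fps_deriv (Q ^ N)) l
      = fps_nth (fps_const (real N) * ((fps_X * fps_deriv Q) * Q ^ (N - 1))) l"
    by (rule arg_cong)
  moreover have "fps_nth (fps_X * fps_deriv R) i = real i * fps_nth R i" for R :: "real fps" and i
    by (cases i) auto
  ultimately show ?thesis
    by (simp only: fps_mult_left_const_nth fps_mult_nth[of "fps_X * fps_deriv Q"] atLeast0AtMost)
qed

text \<open>The inequality ln y \<le> y - 1, applied at x and at 1/x, squeezes N ln x between -N (1
  - x) / x and -N (1 - x).\<close>

lemma tendsto_power_exp:
  fixes x :: "nat \<Rightarrow> real" and N :: "nat \<Rightarrow> nat"
  assumes N: "filterlim N at_top sequentially"
    and x: "(\<lambda>m. real (N m) * (1 - x m)) \<longlonglongrightarrow> c"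
  shows "(\<lambda>m. x m ^ N m) \<longlonglongrightarrow> exp (- c)"
proof -
  have inv: "(\<lambda>m. inverse (real (N m))) \<longlonglongrightarrow> 0"
    using N by (intro tendsto_inverse_0_at_top filterlim_compose[OF filterlim_real_sequentially])
  have Npos: "eventually (\<lambda>m. N m > 0) sequentially"
    using N eventually_gt_at_top[of "0::nat"] by (auto simp: filterlim_iff)
  \<comment> \<open>Since N tends to infinity while N (1 - x) stays bounded, x tends to 1. This
    makes the logarithms meaningful eventually and gives both bounds the same limit.\<close>
  have "(\<lambda>m. inverse (real (N m)) * (real (N m) * (1 - x m))) \<longlonglongrightarrow> 0 * c"
    by (intro tendsto_mult inv x)
  moreover have "eventually (\<lambda>m. inverse (real (N m)) * (real (N m) * (1 - x m)) = 1 - x m) sequentially"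
    using Npos by eventually_elim (simp add: field_simps)
  ultimately have "(\<lambda>m. 1 - x m) \<longlonglongrightarrow> 0"
    by (simp add: tendsto_cong)
  then have x1: "x \<longlonglongrightarrow> 1"
    using tendsto_diff[OF tendsto_const[of 1], of "\<lambda>m. 1 - x m" 0] by simp
  then have xpos: "eventually (\<lambda>m. x m > 0) sequentially"
    by (rule order_tendstoD) simp
  have "(\<lambda>m. real (N m) * ln (x m)) \<longlonglongrightarrow> - c"
  proof (rule tendsto_sandwich)
    show "eventually (\<lambda>m. - (real (N m) * (1 - x m)) / x m \<le> real (N m) * ln (x m)) sequentially"
      using xpos
    proof eventually_elim
      case (elim m)
      have "ln (inverse (x m)) \<le> inverse (x m) - 1"
        using elim by (intro ln_le_minus_one) auto
      then have "1 - inverse (x m) \<le> ln (x m)"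
        using elim by (simp add: ln_inverse)
      then have "- (1 - x m) / x m \<le> ln (x m)"
        using elim by (simp add: diff_divide_distrib divide_inverse algebra_simps)
      from mult_left_mono[OF this, of "real (N m)"] show ?case
        by (simp only: times_divide_eq_right mult_minus_right)
    qed
    show "eventually (\<lambda>m. real (N m) * ln (x m) \<le> - (real (N m) * (1 - x m))) sequentially"
      using xpos
    proof eventually_elim
      case (elim m)
      have "ln (x m) \<le> x m - 1"
        using elim by (intro ln_le_minus_one) auto
      from mult_left_mono[OF this, of "real (N m)"] show ?case
        by (simp add: algebra_simps)
    qed
    show "(\<lambda>m. - (real (N m) * (1 - x m)) / x m) \<longlonglongrightarrow> - c"
      using tendsto_divide[OF tendsto_minus[OF x] x1] by simp
    show "(\<lambda>m. - (real (N m) * (1 - x m))) \<longlonglongrightarrow> - c"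
      by (intro tendsto_minus x)
  qed
  then have "(\<lambda>m. exp (real (N m) * ln (x m))) \<longlonglongrightarrow> exp (- c)"
    by (rule tendsto_exp)
  moreover have "eventually (\<lambda>m. exp (real (N m) * ln (x m)) = x m ^ N m) sequentially"
    using xpos by eventually_elim (simp add: exp_of_nat_mult)
  ultimately show ?thesis
    by (simp add: tendsto_cong)
qed

lemma filterlim_pred:
  fixes N :: "nat \<Rightarrow> nat"
  assumes "filterlim N at_top sequentially"
  shows "filterlim (\<lambda>m. N m - 1) at_top sequentially"
  unfolding filterlim_at_top
proof
  fix B
  have "eventually (\<lambda>m. B + 1 \<le> N m) sequentially"
    using assms by (auto simp: filterlim_at_top)
  then show "eventually (\<lambda>m. B \<le> N m - 1) sequentially"
    by eventually_elim auto
qed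

text \<open>The recursion lowers the exponent by one. This changes \<open>N m * x m\<close> by
  \<open>x m\<close>, which is \<open>N m * x m\<close> divided by \<open>N m\<close> and hence
  vanishes in the limit.\<close>

lemma tendsto_pred_mult:
  fixes N :: "nat \<Rightarrow> nat" and x :: "nat \<Rightarrow> real"
  assumes N: "filterlim N at_top sequentially"
    and x: "(\<lambda>m. real (N m) * x m) \<longlonglongrightarrow> d"
  shows "(\<lambda>m. real (N m - 1) * x m) \<longlonglongrightarrow> d"
proof -
  have inv: "(\<lambda>m. inverse (real (N m))) \<longlonglongrightarrow> 0"
    using N by (intro tendsto_inverse_0_at_top filterlim_compose[OF filterlim_real_sequentially])
  have Npos: "eventually (\<lambda>m. N m > 0) sequentially"
    using N eventually_gt_at_top[of "0::nat"] by (auto simp: filterlim_iff)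
  have "(\<lambda>m. real (N m) * x m - inverse (real (N m)) * (real (N m) * x m)) \<longlonglongrightarrow> d - 0 * d"
    by (intro tendsto_intros inv x)
  moreover have "eventually (\<lambda>m. real (N m) * x m - inverse (real (N m)) * (real (N m) * x m)
      = real (N m - 1) * x m) sequentially"
    using Npos by eventually_elim (simp add: field_simps)
  ultimately show ?thesis
    by (simp add: tendsto_cong)
qed

text \<open>Panjer's recursion expresses the coefficient of index \<open>l\<close> for exponent
  \<open>N m\<close> by those of smaller index for exponent \<open>N m - 1\<close>. The induction
  therefore runs over \<open>l\<close> with \<open>N\<close> arbitrary; the hypotheses on
  \<open>N\<close> survive the decrement.\<close>

lemma tendsto_fps_power_nth:
  fixes Q :: "nat \<Rightarrow> real fps" and N :: "nat \<Rightarrow> nat" and q a :: "nat \<Rightarrow> real"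
  assumes "filterlim N at_top sequentially"
    and "(\<lambda>m. real (N m) * (1 - fps_nth (Q m) 0)) \<longlonglongrightarrow> c"
    and "\<And>i. i \<ge> 1 \<Longrightarrow> (\<lambda>m. real (N m) * fps_nth (Q m) i) \<longlonglongrightarrow> q i"
    and a0: "a 0 = exp (- c)"
    and a_rec: "\<And>l. l \<ge> 1 \<Longrightarrow> real l * a l = (\<Sum>i=1..l. real i * q i * a (l - i))"
  shows "(\<lambda>m. fps_nth (Q m ^ N m) l) \<longlonglongrightarrow> a l"
  using assms(1-3)
proof (induction l arbitrary: N rule: less_induct)
  case (less l)
  note N = less.prems(1) and Q0 = less.prems(2) and Qi = less.prems(3)
  show ?case
  proof (cases "l = 0")
    case True
    then show ?thesis
      using tendsto_power_exp[OF N Q0] a0 by (simp add: fps_power_zeroth)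
  next
    case False
    have IH: "(\<lambda>m. fps_nth (Q m ^ (N m - 1)) l') \<longlonglongrightarrow> a l'" if "l' < l" for l'
      using that by (intro less.IH filterlim_pred tendsto_pred_mult N Q0 Qi)
    have "(\<lambda>m. (\<Sum>i=1..l. real i * (real (N m) * fps_nth (Q m) i) * fps_nth (Q m ^ (N m - 1)) (l - i)) / real l)
        \<longlonglongrightarrow> (\<Sum>i=1..l. real i * q i * a (l - i)) / real l"
      using False by (intro tendsto_intros Qi IH) auto
    moreover have "(\<Sum>i=1..l. real i * (real (N m) * fps_nth (Q m) i) * fps_nth (Q m ^ (N m - 1)) (l - i)) / real l
        = fps_nth (Q m ^ N m) l" for m
    proof -
      \<comment> \<open>The term \<open>i = 0\<close> has weight 0. Without it, only coefficients of
        index below \<open>l\<close> occur on the right, and only limits of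
        \<open>N m * fps_nth (Q m) i\<close> with \<open>i \<ge> 1\<close>.\<close>
      have "(\<Sum>i\<le>l. real i * fps_nth (Q m) i * fps_nth (Q m ^ (N m - 1)) (l - i))
         = (\<Sum>i=1..l. real i * fps_nth (Q m) i * fps_nth (Q m ^ (N m - 1)) (l - i))"
        by (intro sum.mono_neutral_right) auto
      then show ?thesis
        using False fps_power_panjer[of l "Q m" "N m"]
        by (simp add: field_simps sum_distrib_left)
    qed
    moreover have "(\<Sum>i=1..l. real i * q i * a (l - i)) / real l = a l"
      using False a_rec[of l] by (simp add: field_simps)
    ultimately show ?thesis
      by simp
  qed
qed

section \<open>Compound Poisson sums\<close>

text \<open>Index 0 of a single independent family carries \<open>\<Lambda>\<close>, so one
  assumption states both that the summands are mutually independent and that they are independent of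
  their number.\<close>

locale compound_poisson = prob_space M for M :: "'a measure" +
  fixes \<Lambda> :: "'a \<Rightarrow> nat" and X :: "nat \<Rightarrow> 'a \<Rightarrow> nat" and \<theta> :: real and p :: "nat \<Rightarrow> real"
  assumes indep: "indep_vars (\<lambda>_. count_space UNIV) (\<lambda>j. if j = 0 then \<Lambda> else X j) UNIV"
    and prob_\<Lambda>: "\<And>r. prob {\<omega> \<in> space M. \<Lambda> \<omega> = r} = \<theta> ^ r / fact r * exp (- \<theta>)"
    and prob_X: "\<And>j i. j \<ge> 1 \<Longrightarrow> prob {\<omega> \<in> space M. X j \<omega> = i} = p i"
begin

lemma measurable_\<Lambda> [measurable]: "\<Lambda> \<in> measurable M (count_space UNIV)"
  using indep unfolding indep_vars_def2 by (metis UNIV_I)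

lemma measurable_X: "j \<ge> 1 \<Longrightarrow> X j \<in> measurable M (count_space UNIV)"
  using indep unfolding indep_vars_def2 by (metis UNIV_I not_one_le_zero)

lemma measurable_sum_upto_\<Lambda>:
  fixes h :: "nat \<Rightarrow> 'b::{topological_comm_monoid_add, second_countable_topology}"
  shows "(\<lambda>\<omega>. \<Sum>j=1..\<Lambda> \<omega>. h (X j \<omega>)) \<in> borel_measurable M"
proof -
  have [measurable]: "(\<lambda>\<omega>. h (X j \<omega>)) \<in> borel_measurable M" if "j \<in> {1..r}" for j r
    using measurable_compose[OF measurable_X[of j], of h borel] that by simp
  have "(\<lambda>\<omega>. \<Sum>j=1..r. h (X j \<omega>)) \<in> borel_measurable M" for r
    by measurable
  then show ?thesis
    by (rule measurable_compose_countable[OF _ measurable_\<Lambda>])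
qed

lemma measurable_d_star [measurable]: "d_star \<Lambda> X \<in> measurable M (count_space UNIV)"
proof -
  have [measurable]: "X j \<in> measurable M (count_space UNIV)" if "j \<in> {1..r}" for j r
    using measurable_X[of j] that by simp
  have "(\<lambda>\<omega>. \<Sum>j=1..r. X j \<omega>) \<in> measurable M (count_space UNIV)" for r
    by measurable
  then show ?thesis
    unfolding d_star_def by (rule measurable_compose_countable[OF _ measurable_\<Lambda>])
qed

text \<open>This is the product hypothesis of the lemmas on sums, with \<open>A\<close> the event
  \<open>\<Lambda> = r\<close> and \<open>c\<close> its Poisson weight.\<close>

lemma prob_\<Lambda>_X:
  "prob ({\<omega> \<in> space M. \<Lambda> \<omega> = r} \<inter> {\<omega> \<in> space M. \<forall>j\<in>{1..r}. X j \<omega> = y j})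
    = \<theta> ^ r / fact r * exp (- \<theta>) * (\<Prod>j\<in>{1..r}. fps_nth (Abs_fps p) (y j))"
proof -
  define B where "B j = {if j = 0 then r else y j}" for j :: nat
  have "{\<omega> \<in> space M. \<Lambda> \<omega> = r} \<inter> {\<omega> \<in> space M. \<forall>j\<in>{1..r}. X j \<omega> = y j}
      = (\<Inter>j\<in>{0..r}. (if j = 0 then \<Lambda> else X j) -` B j \<inter> space M)"
    by (force simp: B_def split: if_splits)
  also have "prob \<dots> = (\<Prod>j\<in>{0..r}. prob ((if j = 0 then \<Lambda> else X j) -` B j \<inter> space M))"
    by (rule indep_varsD[OF indep]) auto
  also have "\<dots> = (\<Prod>j\<in>{0..r}. if j = 0 then \<theta> ^ r / fact r * exp (- \<theta>) else p (y j))"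
  proof (rule prod.cong)
    fix j assume "j \<in> {0..r}"
    show "prob ((if j = 0 then \<Lambda> else X j) -` B j \<inter> space M)
        = (if j = 0 then \<theta> ^ r / fact r * exp (- \<theta>) else p (y j))"
      using prob_\<Lambda>[of r] prob_X[of j "y j"]
      by (auto simp: B_def vimage_def Int_def conj_commute)
  qed simp
  also have "\<dots> = \<theta> ^ r / fact r * exp (- \<theta>) * (\<Prod>j\<in>{1..r}. p (y j))"
    by (simp add: prod.atLeast_Suc_atMost)
  finally show ?thesis
    by simp
qed

text \<open>Decompose by the value \<open>r\<close> of \<open>\<Lambda>\<close>; on this event
  \<open>d_star\<close> is a sum of \<open>r\<close> independent terms.\<close>

lemma prob_d_star_sums:
  "(\<lambda>r. \<theta> ^ r / fact r * exp (- \<theta>) * fps_nth (Abs_fps p ^ r) l)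
    sums prob {\<omega> \<in> space M. d_star \<Lambda> X \<omega> = l}"
proof -
  have "(\<lambda>r. prob ({\<omega> \<in> space M. \<Lambda> \<omega> = r} \<inter> {\<omega> \<in> space M. (\<Sum>j=1..r. X j \<omega>) = l}))
      sums prob (\<Union>r. {\<omega> \<in> space M. \<Lambda> \<omega> = r} \<inter> {\<omega> \<in> space M. (\<Sum>j=1..r. X j \<omega>) = l})"
  proof (rule finite_measure_UNION)
    have [measurable]: "X j \<in> measurable M (count_space UNIV)" if "j \<in> {1..r}" for j r
      using measurable_X[of j] that by simp
    have "{\<omega> \<in> space M. \<Lambda> \<omega> = r} \<inter> {\<omega> \<in> space M. (\<Sum>j=1..r. X j \<omega>) = l} \<in> events" for r
      by measurable
    then show "range (\<lambda>r. {\<omega> \<in> space M. \<Lambda> \<omega> = r} \<inter> {\<omega> \<in> space M. (\<Sum>j=1..r. X j \<omega>) = l}) \<subseteq> events"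
      by blast
  qed (auto simp: disjoint_family_on_def)
  also have "(\<Union>r. {\<omega> \<in> space M. \<Lambda> \<omega> = r} \<inter> {\<omega> \<in> space M. (\<Sum>j=1..r. X j \<omega>) = l})
      = {\<omega> \<in> space M. d_star \<Lambda> X \<omega> = l}"
    by (auto simp: d_star_def)
  also have "(\<lambda>r. prob ({\<omega> \<in> space M. \<Lambda> \<omega> = r} \<inter> {\<omega> \<in> space M. (\<Sum>j=1..r. X j \<omega>) = l}))
      = (\<lambda>r. \<theta> ^ r / fact r * exp (- \<theta>) * fps_nth (Abs_fps p ^ r) l)"
  proof
    fix r
    show "prob ({\<omega> \<in> space M. \<Lambda> \<omega> = r} \<inter> {\<omega> \<in> space M. (\<Sum>j=1..r. X j \<omega>) = l})
      = \<theta> ^ r / fact r * exp (- \<theta>) * fps_nth (Abs_fps p ^ r) l"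
      using prob_sum_eq_fps_power[OF _ _ _ prob_\<Lambda>_X, of r l] measurable_X by simp
  qed
  finally show ?thesis .
qed

text \<open>The summands may vanish, so every value of \<open>\<Lambda>\<close> contributes, and the
  contributions form an exponential series in \<theta> p(0). This is the initial value of the
  recursion.\<close>

lemma prob_d_star_0: "prob {\<omega> \<in> space M. d_star \<Lambda> X \<omega> = 0} = exp (- (\<theta> * (1 - p 0)))"
proof -
  have "(\<lambda>r. exp (- \<theta>) * ((\<theta> * p 0) ^ r /\<^sub>R fact r)) sums (exp (- \<theta>) * exp (\<theta> * p 0))"
    by (intro sums_mult exp_converges)
  moreover have "(\<lambda>r. exp (- \<theta>) * ((\<theta> * p 0) ^ r /\<^sub>R fact r))
      = (\<lambda>r. \<theta> ^ r / fact r * exp (- \<theta>) * fps_nth (Abs_fps p ^ r) 0)"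
    by (simp add: fun_eq_iff fps_power_zeroth field_simps)
  ultimately have "prob {\<omega> \<in> space M. d_star \<Lambda> X \<omega> = 0} = exp (- \<theta>) * exp (\<theta> * p 0)"
    using sums_unique2[OF prob_d_star_sums[of 0]] by simp
  also have "\<dots> = exp (- (\<theta> * (1 - p 0)))"
    by (simp add: mult_exp_exp algebra_simps)
  finally show ?thesis .
qed

text \<open>On \<open>\<Lambda> = r\<close> the \<open>r\<close> summands contribute equally. The
  factor \<open>r\<close> turns \<theta>^r / r! into \<theta> times the preceding Poisson weight,
  while the remaining \<open>r - 1\<close> summands must add up to \<open>l - i\<close>; summing
  over \<open>r\<close> gives the law of \<open>d_star\<close> again.\<close>

lemma expectation_d_star_panjer:
  fixes g :: "nat \<Rightarrow> real"
  assumes g: "\<And>i. 0 \<le> g i" "\<And>i. g i \<le> (real i)\<^sup>2"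
  shows "expectation (\<lambda>\<omega>. (\<Sum>j=1..\<Lambda> \<omega>. g (X j \<omega>)) * indicator {\<omega> \<in> space M. d_star \<Lambda> X \<omega> = l} \<omega>)
    = \<theta> * (\<Sum>i\<le>l. g i * p i * prob {\<omega> \<in> space M. d_star \<Lambda> X \<omega> = l - i})"
proof -
  define F where "F \<omega> = (\<Sum>j=1..\<Lambda> \<omega>. g (X j \<omega>)) * indicator {\<omega> \<in> space M. d_star \<Lambda> X \<omega> = l} \<omega>" for \<omega>
  define A where "A r = {\<omega> \<in> space M. \<Lambda> \<omega> = r}" for r
  define R where "R r = {\<omega> \<in> space M. (\<Sum>j=1..r. X j \<omega>) = l}" for r
  define e where "e r = \<theta> ^ r / fact r * exp (- \<theta>) * (real r *
    (\<Sum>i\<le>l. g i * p i * fps_nth (Abs_fps p ^ (r - 1)) (l - i)))" for r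
  have [measurable]: "(\<lambda>\<omega>. \<Sum>j=1..\<Lambda> \<omega>. g (X j \<omega>)) \<in> borel_measurable M"
    by (rule measurable_sum_upto_\<Lambda>)
  have F_meas[measurable]: "F \<in> borel_measurable M"
    unfolding F_def by measurable
  \<comment> \<open>On \<open>d_star = l\<close> each summand is at most \<open>l\<close>, so the
    sum of squares is at most \<open>l\<close> times the sum. The quadratic bound on
    \<open>g\<close> thus gives integrability without any moment of the summands.\<close>
  have F_bound: "norm (F \<omega>) \<le> (real l)\<^sup>2" for \<omega>
  proof (cases "d_star \<Lambda> X \<omega> = l")
    case True
    have "(\<Sum>j=1..\<Lambda> \<omega>. g (X j \<omega>)) \<le> (\<Sum>j=1..\<Lambda> \<omega>. real (X j \<omega>) * real l)"
    proof (rule sum_mono)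
      fix j assume "j \<in> {1..\<Lambda> \<omega>}"
      then have "X j \<omega> \<le> l"
        using True member_le_sum[of j "{1..\<Lambda> \<omega>}" "\<lambda>j. X j \<omega>"] by (simp add: d_star_def)
      then have "(real (X j \<omega>))\<^sup>2 \<le> real (X j \<omega>) * real l"
        by (simp add: power2_eq_square mult_left_mono)
      then show "g (X j \<omega>) \<le> real (X j \<omega>) * real l"
        using g(2)[of "X j \<omega>"] by linarith
    qed
    also have "\<dots> = (real l)\<^sup>2"
      using True by (simp add: d_star_def power2_eq_square flip: sum_distrib_right of_nat_sum)
    finally show ?thesis
      using g(1) by (auto simp: F_def indicator_def sum_nonneg)
  qed (auto simp: F_def)
  have F_int: "integrable M F"
    by (rule integrable_const_bound[of _ "(real l)\<^sup>2"]) (use F_bound in auto)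
  have LINT_A: "(LINT \<omega>:A r|M. F \<omega>) = e r" for r
  proof -
    have [measurable]: "X j \<in> measurable M (count_space UNIV)" if "j \<in> {1..r}" for j
      using measurable_X[of j] that by simp
    have [measurable]: "A r \<in> events" "R r \<in> events"
      unfolding A_def R_def by measurable
    have int: "integrable M (\<lambda>\<omega>. g (X j \<omega>) * indicator (A r \<inter> R r) \<omega>)" if j: "j \<in> {1..r}" for j
    proof (rule integrable_const_bound[of _ "(real l)\<^sup>2"])
      have "norm (g (X j \<omega>) * indicator (A r \<inter> R r) \<omega>) \<le> (real l)\<^sup>2" for \<omega>
      proof (cases "\<omega> \<in> A r \<inter> R r")
        case True
        then have "X j \<omega> \<le> l"
          using j member_le_sum[of j "{1..r}" "\<lambda>j. X j \<omega>"] by (simp add: R_def)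
        then have "(real (X j \<omega>))\<^sup>2 \<le> (real l)\<^sup>2"
          by (intro power_mono) auto
        with g(2)[of "X j \<omega>"] have "g (X j \<omega>) \<le> (real l)\<^sup>2"
          by linarith
        then show ?thesis
          using g(1) True by simp
      qed auto
      then show "AE \<omega> in M. norm (g (X j \<omega>) * indicator (A r \<inter> R r) \<omega>) \<le> (real l)\<^sup>2"
        by simp
      have [measurable]: "(\<lambda>\<omega>. g (X j \<omega>)) \<in> borel_measurable M"
        using measurable_compose[OF measurable_X[of j], of g borel] j by simp
      show "(\<lambda>\<omega>. g (X j \<omega>) * indicator (A r \<inter> R r) \<omega>) \<in> borel_measurable M"
        by measurable
    qed
    have "(LINT \<omega>:A r|M. F \<omega>) = expectation (\<lambda>\<omega>. \<Sum>j=1..r. g (X j \<omega>) * indicator (A r \<inter> R r) \<omega>)"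
      unfolding set_lebesgue_integral_def
      by (rule Bochner_Integration.integral_cong)
        (auto simp: A_def R_def F_def d_star_def indicator_def)
    also have "\<dots> = (\<Sum>j=1..r. expectation (\<lambda>\<omega>. g (X j \<omega>) * indicator (A r \<inter> R r) \<omega>))"
      using int by (rule Bochner_Integration.integral_sum)
    also have "\<dots> = (\<Sum>j=1..r. \<theta> ^ r / fact r * exp (- \<theta>) *
        (\<Sum>i\<le>l. g i * p i * fps_nth (Abs_fps p ^ (r - 1)) (l - i)))"
    proof (rule sum.cong)
      fix j assume "j \<in> {1..r}"
      then show "expectation (\<lambda>\<omega>. g (X j \<omega>) * indicator (A r \<inter> R r) \<omega>) = \<theta> ^ r / fact r * exp (- \<theta>) *
        (\<Sum>i\<le>l. g i * p i * fps_nth (Abs_fps p ^ (r - 1)) (l - i))"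
        using expectation_weighted_sum_eq[OF _ _ _ _ prob_\<Lambda>_X, of r j g l] measurable_X
        by (simp add: A_def R_def)
    qed simp
    also have "\<dots> = e r"
      by (simp add: e_def)
    finally show ?thesis .
  qed
  have "(LINT \<omega>:(\<Union>r. A r)|M. F \<omega>) = (\<Sum>r. (LINT \<omega>:A r|M. F \<omega>))"
  proof (rule lebesgue_integral_countable_add)
    show "A r \<in> events" for r
      unfolding A_def by measurable
    show "set_integrable M (\<Union>r. A r) F"
      unfolding set_integrable_def A_def
      by (intro integrable_mult_indicator F_int) measurable
  qed (auto simp: A_def)
  also have "(LINT \<omega>:(\<Union>r. A r)|M. F \<omega>) = expectation F"
    unfolding set_lebesgue_integral_def
    by (rule Bochner_Integration.integral_cong) (auto simp: A_def)
  finally have "expectation F = (\<Sum>r. e r)"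
    by (simp add: LINT_A)
  moreover have "e sums (\<theta> * (\<Sum>i\<le>l. g i * p i * prob {\<omega> \<in> space M. d_star \<Lambda> X \<omega> = l - i}))"
  proof -
    have "(\<lambda>r. \<theta> * (\<Sum>i\<le>l. g i * p i * (\<theta> ^ r / fact r * exp (- \<theta>) * fps_nth (Abs_fps p ^ r) (l - i))))
      sums (\<theta> * (\<Sum>i\<le>l. g i * p i * prob {\<omega> \<in> space M. d_star \<Lambda> X \<omega> = l - i}))"
      by (intro sums_mult sums_sum prob_d_star_sums)
    \<comment> \<open>Shift of the summation index: the term for \<open>r\<close> in the series for
      \<open>d_star\<close> is the term for \<open>Suc r\<close> in \<open>e\<close>, and
      \<open>e 0\<close> is zero.\<close>
    moreover have "\<theta> * (\<Sum>i\<le>l. g i * p i * (\<theta> ^ r / fact r * exp (- \<theta>) * fps_nth (Abs_fps p ^ r) (l - i)))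
        = e (Suc r)" for r
    proof -
      have "\<theta> ^ Suc r / fact (Suc r) * real (Suc r) = \<theta> * (\<theta> ^ r / fact r)"
        by (simp add: divide_simps)
      then have "e (Suc r) = \<theta> * (\<theta> ^ r / fact r) * exp (- \<theta>)
          * (\<Sum>i\<le>l. g i * p i * fps_nth (Abs_fps p ^ r) (l - i))"
        by (simp add: e_def mult_ac)
      then show ?thesis
        by (simp add: sum_distrib_left mult_ac)
    qed
    moreover have "e 0 = 0"
      by (simp add: e_def)
    ultimately show ?thesis
      using sums_Suc_iff[of e] by simp
  qed
  ultimately show ?thesis
    by (simp add: F_def[abs_def] sums_iff)
qed

text \<open>Take the identity for \<open>g\<close>: the weighted sum is then \<open>d_star\<close>
  itself, which is constantly \<open>l\<close> on the event.\<close>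

lemma prob_d_star_panjer:
  "real l * prob {\<omega> \<in> space M. d_star \<Lambda> X \<omega> = l}
    = \<theta> * (\<Sum>i\<le>l. real i * p i * prob {\<omega> \<in> space M. d_star \<Lambda> X \<omega> = l - i})"
proof -
  have "expectation (\<lambda>\<omega>. (\<Sum>j=1..\<Lambda> \<omega>. real (X j \<omega>)) * indicator {\<omega> \<in> space M. d_star \<Lambda> X \<omega> = l} \<omega>)
      = expectation (\<lambda>\<omega>. real l * indicator {\<omega> \<in> space M. d_star \<Lambda> X \<omega> = l} \<omega>)"
    by (rule Bochner_Integration.integral_cong) (auto simp: d_star_def indicator_def)
  also have "\<dots> = real l * prob {\<omega> \<in> space M. d_star \<Lambda> X \<omega> = l}"
    by (simp add: Int_def conj_commute)
  finally show ?thesis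
    using expectation_d_star_panjer[of real l]
    by (simp add: power2_eq_square mult_le_cancel_left1)
qed

end

section \<open>Random subsets\<close>

lemma set_random_subset_pmf:
  assumes "set_pmf P \<subseteq> {..m}"
  shows "set_pmf (random_subset_pmf m P) \<subseteq> Pow {1..m}"
proof
  fix A assume "A \<in> set_pmf (random_subset_pmf m P)"
  then show "A \<in> Pow {1..m}"
    using pmf_random_subset[OF assms, of A] by (metis PowI set_pmf_iff)
qed

text \<open>Removing \<open>F\<close> maps its supersets of size \<open>s\<close> bijectively to the
  subsets of size \<open>s - card F\<close> of the complement. The quotient of binomial coefficients
  then simplifies by \<open>choose_mult\<close>.\<close>

lemma prob_random_subset_supset_card:
  assumes P: "set_pmf P \<subseteq> {..m}" and F: "F \<subseteq> {1..m}"
  shows "measure_pmf.prob (random_subset_pmf m P) {A. F \<subseteq> A \<and> card A = s}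
    = pmf P s * real (s choose card F) / real (m choose card F)"
proof -
  let ?r = "card F"
  have finF: "finite F"
    using F finite_subset by blast
  have rm: "?r \<le> m"
    using card_mono[OF _ F] by simp
  define S where "S = {A. F \<subseteq> A \<and> A \<subseteq> {1..m} \<and> card A = s}"
  have finS: "finite S"
    unfolding S_def by (rule finite_subset[of _ "Pow {1..m}"]) auto
  have "measure_pmf.prob (random_subset_pmf m P) {A. F \<subseteq> A \<and> card A = s}
      = measure_pmf.prob (random_subset_pmf m P) S"
    using set_random_subset_pmf[OF P] by (intro measure_prob_cong_0) (auto simp: S_def set_pmf_iff)
  also have "\<dots> = (\<Sum>A\<in>S. pmf P s / real (m choose s))"
    unfolding measure_measure_pmf_finite[OF finS]
    by (rule sum.cong) (auto simp: S_def pmf_random_subset[OF P])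
  also have "\<dots> = real (card S) * (pmf P s / real (m choose s))"
    by simp
  also have "\<dots> = pmf P s * real (s choose ?r) / real (m choose ?r)"
  proof (cases "?r \<le> s \<and> s \<le> m")
    case True
    have "bij_betw (\<lambda>A. A - F) S {B. B \<subseteq> {1..m} - F \<and> card B = s - ?r}"
    proof (rule bij_betwI[where g = "\<lambda>B. B \<union> F"])
      show "(\<lambda>A. A - F) \<in> S \<rightarrow> {B. B \<subseteq> {1..m} - F \<and> card B = s - ?r}"
        using finF by (auto simp: S_def card_Diff_subset)
      show "(\<lambda>B. B \<union> F) \<in> {B. B \<subseteq> {1..m} - F \<and> card B = s - ?r} \<rightarrow> S"
      proof
        fix B assume B: "B \<in> {B. B \<subseteq> {1..m} - F \<and> card B = s - ?r}"
        then have "finite B" "B \<inter> F = {}"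
          using finite_subset[of B "{1..m} - F"] by auto
        then have "card (B \<union> F) = card B + card F"
          using finF by (intro card_Un_disjoint)
        then show "B \<union> F \<in> S"
          using B F True by (auto simp: S_def)
      qed
    qed (auto simp: S_def)
    then have "card S = card {B. B \<subseteq> {1..m} - F \<and> card B = s - ?r}"
      by (rule bij_betw_same_card)
    also have "\<dots> = ((m - ?r) choose (s - ?r))"
      using n_subsets[of "{1..m} - F" "s - ?r"] finF F by (simp add: card_Diff_subset)
    finally have "(m choose s) * (s choose ?r) = (m choose ?r) * card S"
      using choose_mult[of ?r s m] True by simp
    then have "real (m choose s) * real (s choose ?r) = real (m choose ?r) * real (card S)"
      by (metis of_nat_mult)
    moreover have "real (m choose s) > 0" "real (m choose ?r) > 0"
      using True rm by simp_all
    ultimately show ?thesis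
      by (simp add: field_simps)
  next
    \<comment> \<open>Both sides vanish: either no set of size \<open>s\<close> can contain
      \<open>F\<close>, or \<open>s\<close> lies outside the support of \<open>P\<close>.\<close>
    case False
    then consider "s < ?r" | "m < s"
      by linarith
    then show ?thesis
    proof cases
      case 1
      have "S = {}"
      proof (rule ccontr)
        assume "S \<noteq> {}"
        then obtain A where "F \<subseteq> A" "A \<subseteq> {1..m}" "card A = s"
          by (auto simp: S_def)
        then show False
          using 1 card_mono[of A F] finite_subset[of A "{1..m}"] by simp
      qed
      then show ?thesis
        using 1 by simp
    next
      case 2
      then have "pmf P s = 0"
        using P by (auto simp: set_pmf_eq)
      then show ?thesis
        by simp
    qed
  qed
  finally show ?thesis .
qed

lemma prob_random_subset_supset:
  assumes P: "set_pmf P \<subseteq> {..m}" and F: "F \<subseteq> {1..m}"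
  shows "measure_pmf.prob (random_subset_pmf m P) {A. F \<subseteq> A}
    = measure_pmf.expectation P (\<lambda>x. real (x choose card F)) / real (m choose card F)"
proof -
  let ?p = "random_subset_pmf m P"
  have "measure_pmf.prob ?p {A. F \<subseteq> A} = measure_pmf.prob ?p (\<Union>s\<in>{..m}. {A. F \<subseteq> A \<and> card A = s})"
  proof (rule measure_prob_cong_0)
    fix A assume A: "A \<in> {A. F \<subseteq> A} - (\<Union>s\<in>{..m}. {A. F \<subseteq> A \<and> card A = s})"
    then have "\<not> A \<subseteq> {1..m}"
      using card_mono[of "{1..m}" A] by auto
    then show "pmf ?p A = 0"
      by (simp add: pmf_random_subset[OF P])
  qed auto
  also have "\<dots> = (\<Sum>s\<le>m. measure_pmf.prob ?p {A. F \<subseteq> A \<and> card A = s})"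
    by (rule measure_pmf.finite_measure_finite_Union) (auto simp: disjoint_family_on_def)
  also have "\<dots> = (\<Sum>s\<le>m. real (s choose card F) * pmf P s) / real (m choose card F)"
    by (simp add: prob_random_subset_supset_card[OF P F] sum_divide_distrib mult.commute)
  also have "(\<Sum>s\<le>m. real (s choose card F) * pmf P s) = measure_pmf.expectation P (\<lambda>x. real (x choose card F))"
    using P by (subst integral_measure_pmf[of "{..m}"]) (auto simp: mult.commute)
  finally show ?thesis .
qed

text \<open>For r \<le> 3 the binomial moment is at most the third moment, and (m choose r) is at
  least (m/r)^r, where r^r is at most 27. The union bounds below use sets of two or three attributes
  only.\<close>

lemma prob_random_subset_supset_le:
  assumes P: "set_pmf P \<subseteq> {..m}" and F: "F \<subseteq> {1..m}" and r: "card F = r" "1 \<le> r" "r \<le> 3"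
  shows "measure_pmf.prob (random_subset_pmf m P) {A. F \<subseteq> A}
    \<le> 27 * measure_pmf.expectation P (\<lambda>x. real x ^ 3) / real m ^ r"
proof -
  have rm: "r \<le> m"
    using card_mono[OF _ F] r by simp
  have fin: "finite (set_pmf P)"
    using P finite_subset by blast
  have le: "real (x choose r) \<le> real x ^ 3" for x
  proof (cases "r \<le> x")
    case True
    then have "x choose r \<le> x ^ r"
      by (rule binomial_le_pow)
    also have "\<dots> \<le> x ^ 3"
      using r \<open>r \<le> x\<close> by (intro power_increasing) auto
    finally show ?thesis
      by (metis of_nat_le_iff of_nat_power)
  qed (simp add: binomial_eq_0)
  have E: "measure_pmf.expectation P (\<lambda>x. real (x choose r)) \<le> measure_pmf.expectation P (\<lambda>x. real x ^ 3)"
    using le by (intro integral_mono integrable_measure_pmf_finite fin) auto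
  have "real m ^ r / 27 \<le> real m ^ r / real r ^ r"
  proof (rule divide_left_mono)
    have "real r ^ r \<le> 3 ^ r"
      using r by (intro power_mono) auto
    also have "\<dots> \<le> 3 ^ 3"
      using r by (intro power_increasing) auto
    finally show "real r ^ r \<le> 27"
      by simp
  qed (use r in auto)
  also have "\<dots> = (real m / real r) ^ r"
    by (simp add: power_divide)
  also have "\<dots> \<le> real (m choose r)"
    using binomial_ge_n_over_k_pow_k[OF rm, where ?'a = real] by simp
  finally have C: "real m ^ r / 27 \<le> real (m choose r)" .
  have "measure_pmf.expectation P (\<lambda>x. real (x choose r)) / real (m choose r)
      \<le> measure_pmf.expectation P (\<lambda>x. real x ^ 3) / (real m ^ r / 27)"
    using E C r rm by (intro frac_le) (auto intro!: integral_nonneg_AE)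
  then show ?thesis
    using prob_random_subset_supset[OF P F] r by (simp add: mult.commute)
qed

text \<open>For \<open>w = 1\<close> and \<open>A = D j\<close> the cardinality is the variable Y_j
  of the overview; the set is empty if \<open>D j\<close> misses \<open>w_1\<close>.\<close>

definition others :: "nat \<Rightarrow> nat set \<Rightarrow> nat set" where
  "others w A = (if w \<in> A then A - {w} else {})"

definition others_fps :: "nat \<Rightarrow> nat pmf \<Rightarrow> real fps" where
  "others_fps m P = Abs_fps (\<lambda>i. measure_pmf.prob (random_subset_pmf m P) {A. card (others 1 A) = i})"

text \<open>For \<open>i \<ge> 1\<close>, having \<open>i\<close> other elements means that
  \<open>A\<close> contains 1 and has size \<open>i + 1\<close>. The factor \<open>i + 1\<close> is
  the origin of the size-biased law in the limit.\<close>

lemma others_fps_nth: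
  assumes P: "set_pmf P \<subseteq> {..m}" and m: "m \<ge> 1" and i: "i \<ge> 1"
  shows "fps_nth (others_fps m P) i = real (i + 1) * pmf P (i + 1) / real m"
proof -
  have "{A. card (others 1 A) = i} = {A. {1} \<subseteq> A \<and> card A = i + 1}"
  proof -
    have "card (others 1 A) = i \<longleftrightarrow> {1} \<subseteq> A \<and> card A = i + 1" for A
    proof (cases "finite A")
      case True
      then show ?thesis
        using i card_gt_0_iff[of A] by (auto simp: others_def card_Diff_singleton)
    next
      case False
      then show ?thesis
        using i by (auto simp: others_def)
    qed
    then show ?thesis
      by blast
  qed
  then show ?thesis
    using prob_random_subset_supset_card[OF P, of "{1}" "i + 1"] m
    by (simp add: others_fps_def mult_ac)
qed

text \<open>A nonzero value means that \<open>A\<close> contains 1 and is not the singleton. The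
  complement 1 - Q_0 is computed because it has order 1/m and n (1 - Q_0) converges.\<close>

lemma others_fps_nth_0:
  assumes P: "set_pmf P \<subseteq> {..m}" and m: "m \<ge> 1"
  shows "1 - fps_nth (others_fps m P) 0 = (measure_pmf.expectation P real - pmf P 1) / real m"
proof -
  let ?p = "random_subset_pmf m P"
  \<comment> \<open>An infinite \<open>A\<close> has cardinality 0 by convention, so the two events
    agree only on the support, where all sets are finite.\<close>
  have eq: "measure_pmf.prob ?p (- {A. card (others 1 A) = 0})
      = measure_pmf.prob ?p ({A. {1} \<subseteq> A} - {A. {1} \<subseteq> A \<and> card A = 1})"
  proof (rule measure_prob_cong_0)
    have *: "card (others 1 A) = 0 \<longleftrightarrow> \<not> ({1} \<subseteq> A \<and> card A \<noteq> 1)" if "A \<in> set_pmf ?p" for A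
    proof -
      have "finite A"
        using set_random_subset_pmf[OF P] that finite_subset[of A "{1..m}"] by auto
      show ?thesis
      proof (cases "1 \<in> A")
        case True
        then have "card (others 1 A) = card A - 1" "card A > 0"
          using \<open>finite A\<close> card_gt_0_iff[of A] by (auto simp: others_def card_Diff_singleton)
        then show ?thesis
          using True by (simp only:) auto
      qed (simp add: others_def)
    qed
    fix A
    show "pmf ?p A = 0" if "A \<in> - {A. card (others 1 A) = 0} - ({A. {1} \<subseteq> A} - {A. {1} \<subseteq> A \<and> card A = 1})"
      using *[of A] that by (auto simp: set_pmf_iff)
    show "pmf ?p A = 0" if "A \<in> ({A. {1} \<subseteq> A} - {A. {1} \<subseteq> A \<and> card A = 1}) - - {A. card (others 1 A) = 0}"
      using *[of A] that by (auto simp: set_pmf_iff)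
  qed
  have "1 - fps_nth (others_fps m P) 0 = measure_pmf.prob ?p (- {A. card (others 1 A) = 0})"
    using measure_pmf.prob_compl[of "{A. card (others 1 A) = 0}" ?p]
    by (simp add: others_fps_def Compl_eq_Diff_UNIV)
  also have "\<dots> = measure_pmf.prob ?p {A. {1} \<subseteq> A} - measure_pmf.prob ?p {A. {1} \<subseteq> A \<and> card A = 1}"
    unfolding eq by (rule measure_pmf.finite_measure_Diff) auto
  also have "\<dots> = (measure_pmf.expectation P real - pmf P 1) / real m"
    using prob_random_subset_supset[OF P, of "{1}"] prob_random_subset_supset_card[OF P, of "{1}" 1] m
    by (simp add: diff_divide_distrib)
  finally show ?thesis .
qed

text \<open>The weight of a set depends only on its size and on whether it lies in
  \<open>{1..m}\<close>; a permutation of \<open>{1..m}\<close> preserves both.\<close>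

lemma map_image_random_subset_pmf:
  assumes P: "set_pmf P \<subseteq> {..m}" and \<pi>: "\<pi> permutes {1..m}"
  shows "map_pmf ((`) \<pi>) (random_subset_pmf m P) = random_subset_pmf m P"
proof (rule pmf_eqI)
  fix B
  define A where "A = inv \<pi> ` B"
  have inj: "inj \<pi>"
    using \<pi> permutes_inj by blast
  have B: "B = \<pi> ` A"
    using \<pi> permutes_surj[OF \<pi>] by (simp add: A_def image_f_inv_f)
  have "\<pi> ` A \<subseteq> {1..m} \<longleftrightarrow> A \<subseteq> {1..m}"
    using permutes_in_image[OF \<pi>] by blast
  moreover have "card (\<pi> ` A) = card A"
    using inj by (intro card_image) (auto intro: inj_on_subset)
  ultimately have "pmf (random_subset_pmf m P) (\<pi> ` A) = pmf (random_subset_pmf m P) A"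
    by (simp add: pmf_random_subset[OF P])
  moreover have "pmf (map_pmf ((`) \<pi>) (random_subset_pmf m P)) (\<pi> ` A) = pmf (random_subset_pmf m P) A"
    using inj by (intro pmf_map_inj' injI) (simp add: inj_image_eq_iff)
  ultimately show "pmf (map_pmf ((`) \<pi>) (random_subset_pmf m P)) B = pmf (random_subset_pmf m P) B"
    using B by simp
qed

section \<open>The neighbourhood of an attribute\<close>

text \<open>Coordinates outside \<open>J\<close> get the trivial condition \<open>UNIV\<close>, with
  factor 1; outside \<open>I\<close> the default value holds on the support.\<close>

lemma prob_Pi_pmf_Ball:
  assumes "finite I" "J \<subseteq> I"
  shows "measure_pmf.prob (Pi_pmf I dflt p) {f. \<forall>j\<in>J. f j \<in> B j} = (\<Prod>j\<in>J. measure_pmf.prob (p j) (B j))"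
proof -
  define B' where "B' j = (if j \<in> J then B j else UNIV)" for j
  have "measure_pmf.prob (Pi_pmf I dflt p) {f. \<forall>j\<in>J. f j \<in> B j}
      = measure_pmf.prob (Pi_pmf I dflt p) (PiE_dflt I dflt B')"
  proof (rule measure_prob_cong_0)
    fix f
    show "pmf (Pi_pmf I dflt p) f = 0" if "f \<in> {f. \<forall>j\<in>J. f j \<in> B j} - PiE_dflt I dflt B'"
      using that set_Pi_pmf_subset[OF assms(1), of dflt p]
      by (auto simp: PiE_dflt_def B'_def set_pmf_iff split: if_splits)
    show "pmf (Pi_pmf I dflt p) f = 0" if "f \<in> PiE_dflt I dflt B' - {f. \<forall>j\<in>J. f j \<in> B j}"
      using that assms(2) by (auto simp: PiE_dflt_def B'_def)
  qed
  also have "\<dots> = (\<Prod>j\<in>I. measure_pmf.prob (p j) (B' j))"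
    by (rule measure_Pi_pmf_PiE_dflt[OF assms(1)])
  also have "\<dots> = (\<Prod>j\<in>J. measure_pmf.prob (p j) (B' j))"
    using assms by (intro prod.mono_neutral_right) (auto simp: B'_def)
  also have "\<dots> = (\<Prod>j\<in>J. measure_pmf.prob (p j) (B j))"
    by (rule prod.cong) (auto simp: B'_def)
  finally show ?thesis .
qed

lemma prob_UN_le_card:
  assumes "finite I" "\<And>i. i \<in> I \<Longrightarrow> measure_pmf.prob p (A i) \<le> b"
  shows "measure_pmf.prob p (\<Union>i\<in>I. A i) \<le> real (card I) * b"
proof -
  have "measure_pmf.prob p (\<Union>i\<in>I. A i) \<le> (\<Sum>i\<in>I. measure_pmf.prob p (A i))"
    using assms by (intro measure_pmf.finite_measure_subadditive_finite) auto
  also have "\<dots> \<le> (\<Sum>i\<in>I. b)"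
    using assms by (intro sum_mono)
  finally show ?thesis
    by simp
qed

definition nbrs :: "nat \<Rightarrow> (nat \<Rightarrow> nat set) \<Rightarrow> nat \<Rightarrow> nat set" where
  "nbrs n D w = (\<Union>j\<in>{1..n}. others w (D j))"

text \<open>The cardinality is the \<open>T\<close> of the overview. Pairs are ordered, to match the
  k (k - 1) ordered pairs of neighbours.\<close>

definition adjacent_nbr_pairs :: "nat \<Rightarrow> (nat \<Rightarrow> nat set) \<Rightarrow> nat \<Rightarrow> (nat \<times> nat) set" where
  "adjacent_nbr_pairs n D w = {(u, v). u \<in> nbrs n D w \<and> v \<in> nbrs n D w \<and> adj n D u v}"

lemma adj_iff_nbrs: "adj n D w u \<longleftrightarrow> u \<in> nbrs n D w"
  by (auto simp: adj_def nbrs_def others_def)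

lemma card_off_diagonal:
  assumes "finite S"
  shows "card {(u, v). u \<in> S \<and> v \<in> S \<and> u \<noteq> v} = card S * (card S - 1)"
proof -
  have "{(u, v). u \<in> S \<and> v \<in> S \<and> u \<noteq> v} = Sigma S (\<lambda>u. S - {u})"
    by auto
  then show ?thesis
    using assms by simp
qed

definition overlap :: "nat \<Rightarrow> nat \<Rightarrow> (nat \<Rightarrow> nat set) set" where
  "overlap n m = {D. \<exists>i\<in>{1..n}. \<exists>j\<in>{1..n}. \<exists>u\<in>{2..m}. i \<noteq> j \<and> {1, u} \<subseteq> D i \<and> {1, u} \<subseteq> D j}"

text \<open>The set \<open>D i\<close> joins two neighbours of 1 for which \<open>D j\<close> and
  \<open>D l\<close> are witnesses other than \<open>D i\<close>. The witnesses may
  coincide.\<close>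

definition extra_edge :: "nat \<Rightarrow> nat \<Rightarrow> (nat \<Rightarrow> nat set) set" where
  "extra_edge n m = {D. \<exists>i j l u v. {i, j, l} \<subseteq> {1..n} \<and> {u, v} \<subseteq> {2..m} \<and> u \<noteq> v \<and> j \<noteq> i \<and> l \<noteq> i \<and>
     {u, v} \<subseteq> D i \<and> {1, u} \<subseteq> D j \<and> {1, v} \<subseteq> D l}"

context
  fixes n m :: nat and P :: "nat pmf"
  assumes P: "set_pmf P \<subseteq> {..m}"
begin

lemma passive_rig_subset:
  assumes "D \<in> set_pmf (passive_rig n m P)"
  shows "D j \<subseteq> {1..m}"
proof (cases "j \<in> {1..n}")
  case True
  then have "D j \<in> set_pmf (random_subset_pmf m P)"
    using assms by (auto simp: passive_rig_def set_Pi_pmf PiE_dflt_def)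
  then show ?thesis
    using set_random_subset_pmf[OF P] by auto
next
  case False
  then show ?thesis
    using assms by (auto simp: passive_rig_def set_Pi_pmf PiE_dflt_def)
qed

lemma nbrs_subset:
  assumes "D \<in> set_pmf (passive_rig n m P)"
  shows "nbrs n D 1 \<subseteq> {2..m}"
proof
  fix u assume "u \<in> nbrs n D 1"
  then obtain j where "u \<in> D j" "u \<noteq> 1"
    by (auto simp: nbrs_def others_def split: if_splits)
  then have "u \<in> {1..m}" "u \<noteq> 1"
    using passive_rig_subset[OF assms, of j] by auto
  then show "u \<in> {2..m}"
    by auto
qed

lemma deg_eq_card_nbrs:
  assumes "D \<in> set_pmf (passive_rig n m P)"
  shows "deg n m D 1 = card (nbrs n D 1)"
proof -
  have "{u \<in> {1..m}. adj n D 1 u} = nbrs n D 1"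
    using nbrs_subset[OF assms] by (auto simp: adj_iff_nbrs)
  then show ?thesis
    by (simp add: deg_def)
qed

lemma card_adjacent_nbr_pairs_le:
  assumes "D \<in> set_pmf (passive_rig n m P)"
  shows "card (adjacent_nbr_pairs n D 1) \<le> (card (nbrs n D 1))\<^sup>2"
proof -
  have "adjacent_nbr_pairs n D 1 \<subseteq> nbrs n D 1 \<times> nbrs n D 1"
    by (auto simp: adjacent_nbr_pairs_def)
  moreover have "finite (nbrs n D 1)"
    using nbrs_subset[OF assms] finite_subset by blast
  ultimately show ?thesis
    using card_mono[of "nbrs n D 1 \<times> nbrs n D 1"] by (simp add: card_cartesian_product power2_eq_square)
qed

text \<open>Without overlap the sets \<open>others 1 (D j)\<close> are disjoint, so their sizes add
  up to the degree. Without an extra edge, every edge between neighbours lies inside one of them, so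
  the adjacent pairs are the disjoint union of their off-diagonal pairs.\<close>

lemma
  assumes D: "D \<in> set_pmf (passive_rig n m P)" and "D \<notin> overlap n m"
  shows card_nbrs_no_overlap: "card (nbrs n D 1) = (\<Sum>j=1..n. card (others 1 (D j)))"
    and card_adjacent_nbr_pairs_no_overlap: "D \<notin> extra_edge n m \<Longrightarrow>
      card (adjacent_nbr_pairs n D 1) = (\<Sum>j=1..n. card (others 1 (D j)) * (card (others 1 (D j)) - 1))"
proof -
  define S where "S j = others 1 (D j)" for j
  have S: "u \<in> S j \<longleftrightarrow> {1, u} \<subseteq> D j \<and> u \<in> {2..m}" for u j
  proof -
    have "u \<in> D j \<Longrightarrow> 1 \<le> u \<and> u \<le> m"
      using passive_rig_subset[OF D, of j] by (meson atLeastAtMost_iff subsetD)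
    then show ?thesis
      by (auto simp: S_def others_def)
  qed
  have fin: "finite (S j)" for j
    by (rule finite_subset[of _ "{2..m}"]) (auto simp: S)
  have disj: "S i \<inter> S j = {}" if "i \<in> {1..n}" "j \<in> {1..n}" "i \<noteq> j" for i j
    using assms(2) that unfolding overlap_def S disjoint_iff by blast
  have "card (\<Union>j\<in>{1..n}. S j) = (\<Sum>j=1..n. card (S j))"
    using fin disj by (intro card_UN_disjoint) auto
  then show "card (nbrs n D 1) = (\<Sum>j=1..n. card (others 1 (D j)))"
    by (simp add: nbrs_def S_def)
  assume no_extra: "D \<notin> extra_edge n m"
  define T where "T j = {(u, v). u \<in> S j \<and> v \<in> S j \<and> u \<noteq> v}" for j
  have "adjacent_nbr_pairs n D 1 = (\<Union>j\<in>{1..n}. T j)"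
  proof (intro equalityI subsetI)
    fix z assume "z \<in> adjacent_nbr_pairs n D 1"
    then obtain u v i j l where z: "z = (u, v)" "u \<noteq> v" and idx: "i \<in> {1..n}" "j \<in> {1..n}" "l \<in> {1..n}"
      and mem: "u \<in> S j" "v \<in> S l" "{u, v} \<subseteq> D i"
      unfolding adjacent_nbr_pairs_def nbrs_def S_def adj_def by blast
    \<comment> \<open>\<open>D i\<close> contains the edge, while \<open>D j\<close> and
      \<open>D l\<close> witness its end points. If \<open>D i\<close> is one of the witnesses it
      contains 1, and then both end points lie in \<open>S i\<close>.\<close>
    have "j = i \<or> l = i"
    proof (rule ccontr)
      assume "\<not> ?thesis"
      then have "{i, j, l} \<subseteq> {1..n} \<and> {u, v} \<subseteq> {2..m} \<and> u \<noteq> v \<and> j \<noteq> i \<and> l \<noteq> i \<and>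
          {u, v} \<subseteq> D i \<and> {1, u} \<subseteq> D j \<and> {1, v} \<subseteq> D l"
        using z idx mem S[of u j] S[of v l] by simp
      then have "D \<in> extra_edge n m"
        unfolding extra_edge_def mem_Collect_eq by (intro exI)
      with no_extra show False ..
    qed
    then have "1 \<in> D i"
      using mem S by auto
    then have "u \<in> S i" "v \<in> S i"
      using mem S by auto
    then show "z \<in> (\<Union>j\<in>{1..n}. T j)"
      using z idx by (auto simp: T_def)
  next
    fix z assume "z \<in> (\<Union>j\<in>{1..n}. T j)"
    then obtain u v j where z: "z = (u, v)" "u \<noteq> v" "j \<in> {1..n}" "u \<in> S j" "v \<in> S j"
      by (auto simp: T_def)
    then have "adj n D u v"
      using S by (auto simp: adj_def)
    then show "z \<in> adjacent_nbr_pairs n D 1"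
      using z by (auto simp: adjacent_nbr_pairs_def nbrs_def S_def)
  qed
  also have "card \<dots> = (\<Sum>j=1..n. card (T j))"
  proof (rule card_UN_disjoint)
    show "\<forall>j\<in>{1..n}. finite (T j)"
    proof
      fix j
      show "finite (T j)"
        by (rule finite_subset[of _ "S j \<times> S j"]) (use fin in \<open>auto simp: T_def\<close>)
    qed
    show "\<forall>i\<in>{1..n}. \<forall>j\<in>{1..n}. i \<noteq> j \<longrightarrow> T i \<inter> T j = {}"
    proof (intro ballI impI)
      fix i j assume "i \<in> {1..n}" "j \<in> {1..n}" "i \<noteq> j"
      from disj[OF this] show "T i \<inter> T j = {}"
        by (auto simp: T_def)
    qed
  qed simp
  finally show "card (adjacent_nbr_pairs n D 1) = (\<Sum>j=1..n. card (others 1 (D j)) * (card (others 1 (D j)) - 1))"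
    using card_off_diagonal[OF fin] by (simp add: T_def S_def)
qed

section \<open>Union bounds for the exceptional events\<close>

lemma prob_passive_rig_supset_le:
  assumes J: "J \<subseteq> {1..n}" and F: "\<And>j. j \<in> J \<Longrightarrow> F j \<subseteq> {1..m} \<and> 1 \<le> card (F j) \<and> card (F j) \<le> 3"
  shows "measure_pmf.prob (passive_rig n m P) {D. \<forall>j\<in>J. F j \<subseteq> D j}
    \<le> (\<Prod>j\<in>J. 27 * measure_pmf.expectation P (\<lambda>x. real x ^ 3) / real m ^ card (F j))"
proof -
  have "measure_pmf.prob (passive_rig n m P) {D. \<forall>j\<in>J. F j \<subseteq> D j}
      = (\<Prod>j\<in>J. measure_pmf.prob (random_subset_pmf m P) {A. F j \<subseteq> A})"
    using prob_Pi_pmf_Ball[OF _ J, of "{}" _ "\<lambda>j. {A. F j \<subseteq> A}"] by (simp add: passive_rig_def)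
  also have "\<dots> \<le> (\<Prod>j\<in>J. 27 * measure_pmf.expectation P (\<lambda>x. real x ^ 3) / real m ^ card (F j))"
    using F prob_random_subset_supset_le[OF P] by (intro prod_mono) auto
  finally show ?thesis .
qed

text \<open>There are at most n^2 m choices of (i, j, u), each requiring two independent sets to
  contain a given pair. For n of order m and bounded third moments this is O(1/m).\<close>

lemma prob_overlap_le:
  defines "C \<equiv> 27 * measure_pmf.expectation P (\<lambda>x. real x ^ 3)"
  shows "measure_pmf.prob (passive_rig n m P) (overlap n m) \<le> real n ^ 2 * real m * (C / real m ^ 2) ^ 2"
proof -
  define I where "I = {(i, j, u). i \<in> {1..n} \<and> j \<in> {1..n} \<and> u \<in> {2..m} \<and> i \<noteq> j}"
  have sub: "I \<subseteq> {1..n} \<times> {1..n} \<times> {2..m}"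
    by (auto simp: I_def)
  have fin: "finite I"
    by (rule finite_subset[OF sub]) simp
  have "card I \<le> n * (n * (m - 1))"
    using card_mono[OF _ sub] by (simp add: card_cartesian_product)
  also have "\<dots> \<le> n ^ 2 * m"
    by (simp add: power2_eq_square)
  finally have card_I: "real (card I) \<le> real n ^ 2 * real m"
    by (metis of_nat_le_iff of_nat_mult of_nat_power)
  have "overlap n m = (\<Union>(i, j, u)\<in>I. {D. {1, u} \<subseteq> D i \<and> {1, u} \<subseteq> D j})"
    unfolding overlap_def I_def by blast
  also have "measure_pmf.prob (passive_rig n m P) \<dots> \<le> real (card I) * (C / real m ^ 2) ^ 2"
  proof (rule prob_UN_le_card[OF fin])
    fix x assume "x \<in> I"
    then obtain i j u where x: "x = (i, j, u)" "i \<in> {1..n}" "j \<in> {1..n}" "u \<in> {2..m}" "i \<noteq> j"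
      by (auto simp: I_def)
    then show "measure_pmf.prob (passive_rig n m P) (case x of (i, j, u) \<Rightarrow> {D. {1, u} \<subseteq> D i \<and> {1, u} \<subseteq> D j})
        \<le> (C / real m ^ 2) ^ 2"
      using prob_passive_rig_supset_le[of "{i, j}" "\<lambda>_. {1, u}"]
      by (simp add: C_def power2_eq_square)
  qed
  also have "\<dots> \<le> real n ^ 2 * real m * (C / real m ^ 2) ^ 2"
    using card_I by (intro mult_right_mono) auto
  finally show ?thesis .
qed

text \<open>If the witnesses differ, three independent sets each contain a given pair; if they
  coincide, one set contains a pair and another a triple. With n of order m and bounded third
  moments, both contributions are O(1/m).\<close>

lemma prob_extra_edge_le:
  defines "C \<equiv> 27 * measure_pmf.expectation P (\<lambda>x. real x ^ 3)"
  shows "measure_pmf.prob (passive_rig n m P) (extra_edge n m)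
    \<le> real n ^ 3 * real m ^ 2 * (C / real m ^ 2) ^ 3
      + real n ^ 2 * real m ^ 2 * (C / real m ^ 2 * (C / real m ^ 3))"
proof -
  define I1 where "I1 = {(i, j, l, u, v). i \<in> {1..n} \<and> j \<in> {1..n} \<and> l \<in> {1..n} \<and> u \<in> {2..m} \<and> v \<in> {2..m}
    \<and> u \<noteq> v \<and> j \<noteq> i \<and> l \<noteq> i \<and> j \<noteq> l}"
  define I2 where "I2 = {(i, j, u, v). i \<in> {1..n} \<and> j \<in> {1..n} \<and> u \<in> {2..m} \<and> v \<in> {2..m} \<and> u \<noteq> v \<and> j \<noteq> i}"
  have sub1: "I1 \<subseteq> {1..n} \<times> {1..n} \<times> {1..n} \<times> {2..m} \<times> {2..m}"
    by (auto simp: I1_def)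
  have sub2: "I2 \<subseteq> {1..n} \<times> {1..n} \<times> {2..m} \<times> {2..m}"
    by (auto simp: I2_def)
  have fin1: "finite I1" and fin2: "finite I2"
    by (rule finite_subset[OF sub1], simp) (rule finite_subset[OF sub2], simp)
  have m_le: "(m - 1) * (m - 1) \<le> m * m"
    by (intro mult_le_mono) auto
  have "card I1 \<le> n * (n * (n * ((m - 1) * (m - 1))))"
    using card_mono[OF _ sub1] by (simp add: card_cartesian_product)
  also have "\<dots> \<le> n ^ 3 * m ^ 2"
    using m_le by (simp add: power2_eq_square power3_eq_cube)
  finally have card_I1: "real (card I1) \<le> real n ^ 3 * real m ^ 2"
    by (metis of_nat_le_iff of_nat_mult of_nat_power)
  have "card I2 \<le> n * (n * ((m - 1) * (m - 1)))"
    using card_mono[OF _ sub2] by (simp add: card_cartesian_product)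
  also have "\<dots> \<le> n ^ 2 * m ^ 2"
    using m_le by (simp add: power2_eq_square)
  finally have card_I2: "real (card I2) \<le> real n ^ 2 * real m ^ 2"
    by (metis of_nat_le_iff of_nat_mult of_nat_power)
  have C: "C \<ge> 0"
    by (simp add: C_def integral_nonneg_AE)
  let ?p = "measure_pmf.prob (passive_rig n m P)"
  define E1 where "E1 = (\<Union>(i, j, l, u, v)\<in>I1. {D. {u, v} \<subseteq> D i \<and> {1, u} \<subseteq> D j \<and> {1, v} \<subseteq> D l})"
  define E2 where "E2 = (\<Union>(i, j, u, v)\<in>I2. {D. {u, v} \<subseteq> D i \<and> {1, u, v} \<subseteq> D j})"
  have "extra_edge n m \<subseteq> E1 \<union> E2"
  proof
    fix D assume "D \<in> extra_edge n m"
    then obtain i j l u v where *: "{i, j, l} \<subseteq> {1..n} \<and> {u, v} \<subseteq> {2..m} \<and> u \<noteq> v \<and> j \<noteq> i \<and> l \<noteq> i \<and>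
      {u, v} \<subseteq> D i \<and> {1, u} \<subseteq> D j \<and> {1, v} \<subseteq> D l"
      unfolding extra_edge_def mem_Collect_eq by (elim exE) (rule that)
    then have idx: "i \<in> {1..n}" "j \<in> {1..n}" "l \<in> {1..n}" "u \<in> {2..m}" "v \<in> {2..m}"
        "u \<noteq> v" "j \<noteq> i" "l \<noteq> i"
      and mem: "{u, v} \<subseteq> D i" "{1, u} \<subseteq> D j" "{1, v} \<subseteq> D l"
      by simp_all
    show "D \<in> E1 \<union> E2"
    proof (cases "j = l")
      case True
      then have "(i, j, u, v) \<in> I2" "{u, v} \<subseteq> D i \<and> {1, u, v} \<subseteq> D j"
        using idx mem by (auto simp: I2_def)
      then show ?thesis
        unfolding E2_def by blast
    next
      case False
      then have "(i, j, l, u, v) \<in> I1"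
        using idx by (auto simp: I1_def)
      then show ?thesis
        using mem unfolding E1_def by blast
    qed
  qed
  then have "?p (extra_edge n m) \<le> ?p (E1 \<union> E2)"
    by (intro measure_pmf.finite_measure_mono) auto
  also have "\<dots> \<le> ?p E1 + ?p E2"
    by (intro measure_Un_le) auto
  also have "\<dots> \<le> real (card I1) * (C / real m ^ 2) ^ 3 + real (card I2) * (C / real m ^ 2 * (C / real m ^ 3))"
  proof (rule add_mono)
    show "?p E1 \<le> real (card I1) * (C / real m ^ 2) ^ 3"
      unfolding E1_def
    proof (rule prob_UN_le_card[OF fin1])
      fix x assume "x \<in> I1"
      then obtain i j l u v where x: "x = (i, j, l, u, v)" "i \<in> {1..n}" "j \<in> {1..n}" "l \<in> {1..n}"
        "u \<in> {2..m}" "v \<in> {2..m}" "u \<noteq> v" "j \<noteq> i" "l \<noteq> i" "j \<noteq> l"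
        by (auto simp: I1_def)
      \<comment> \<open>The three requirements become one family indexed by \<open>r\<close>; the
        case distinction is faithful because \<open>i\<close>, \<open>j\<close>, \<open>l\<close>
        are distinct here.\<close>
      have "?p {D. \<forall>r\<in>{i, j, l}. (if r = i then {u, v} else if r = j then {1, u} else {1, v}) \<subseteq> D r}
        \<le> (\<Prod>r\<in>{i, j, l}. C / real m ^ card (if r = i then {u, v} else if r = j then {1, u} else {1, v}))"
        unfolding C_def using x by (intro prob_passive_rig_supset_le) (auto simp: card_insert_if)
      moreover have "{D. \<forall>r\<in>{i, j, l}. (if r = i then {u, v} else if r = j then {1, u} else {1, v}) \<subseteq> D r}
          = {D. {u, v} \<subseteq> D i \<and> {1, u} \<subseteq> D j \<and> {1, v} \<subseteq> D l}"
        using x by auto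
      moreover have "(\<Prod>r\<in>{i, j, l}. C / real m ^ card (if r = i then {u, v} else if r = j then {1, u} else {1, v}))
          = (C / real m ^ 2) ^ 3"
        using x by (simp add: power3_eq_cube power2_eq_square)
      ultimately show "?p (case x of (i, j, l, u, v) \<Rightarrow> {D. {u, v} \<subseteq> D i \<and> {1, u} \<subseteq> D j \<and> {1, v} \<subseteq> D l})
          \<le> (C / real m ^ 2) ^ 3"
        using x(1) by simp
    qed
    show "?p E2 \<le> real (card I2) * (C / real m ^ 2 * (C / real m ^ 3))"
      unfolding E2_def
    proof (rule prob_UN_le_card[OF fin2])
      fix x assume "x \<in> I2"
      then obtain i j u v where x: "x = (i, j, u, v)" "i \<in> {1..n}" "j \<in> {1..n}"
        "u \<in> {2..m}" "v \<in> {2..m}" "u \<noteq> v" "j \<noteq> i"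
        by (auto simp: I2_def)
      have "?p {D. \<forall>r\<in>{i, j}. (if r = i then {u, v} else {1, u, v}) \<subseteq> D r}
        \<le> (\<Prod>r\<in>{i, j}. C / real m ^ card (if r = i then {u, v} else {1, u, v}))"
        unfolding C_def using x by (intro prob_passive_rig_supset_le) (auto simp: card_insert_if)
      moreover have "{D. \<forall>r\<in>{i, j}. (if r = i then {u, v} else {1, u, v}) \<subseteq> D r}
          = {D. {u, v} \<subseteq> D i \<and> {1, u, v} \<subseteq> D j}"
        using x by auto
      moreover have "(\<Prod>r\<in>{i, j}. C / real m ^ card (if r = i then {u, v} else {1, u, v}))
          = C / real m ^ 2 * (C / real m ^ 3)"
        using x by (simp add: power3_eq_cube power2_eq_square)
      ultimately show "?p (case x of (i, j, u, v) \<Rightarrow> {D. {u, v} \<subseteq> D i \<and> {1, u, v} \<subseteq> D j})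
          \<le> C / real m ^ 2 * (C / real m ^ 3)"
        using x(1) by simp
    qed
  qed
  also have "\<dots> \<le> real n ^ 3 * real m ^ 2 * (C / real m ^ 2) ^ 3
      + real n ^ 2 * real m ^ 2 * (C / real m ^ 2 * (C / real m ^ 3))"
    using card_I1 card_I2 C by (intro add_mono mult_right_mono) auto
  finally show ?thesis .
qed

end

section \<open>Reduction by symmetry\<close>

lemma map_image_passive_rig:
  assumes P: "set_pmf P \<subseteq> {..m}" and \<pi>: "\<pi> permutes {1..m}"
  shows "map_pmf (\<lambda>D. (`) \<pi> \<circ> D) (passive_rig n m P) = passive_rig n m P"
  using Pi_pmf_map[of "{1..n}" "(`) \<pi>" "{}" "{}" "\<lambda>_. random_subset_pmf m P"]
    map_image_random_subset_pmf[OF P \<pi>]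
  by (simp add: passive_rig_def)

lemma adj_image:
  assumes "inj \<pi>"
  shows "adj n ((`) \<pi> \<circ> D) (\<pi> u) (\<pi> v) \<longleftrightarrow> adj n D u v"
  using assms by (auto simp: adj_def inj_image_mem_iff inj_eq)

lemma deg_image:
  assumes "\<pi> permutes {1..m}"
  shows "deg n m ((`) \<pi> \<circ> D) (\<pi> w) = deg n m D w"
proof -
  have inj: "inj \<pi>"
    using assms permutes_inj by blast
  have "{u \<in> {1..m}. adj n ((`) \<pi> \<circ> D) (\<pi> w) u} = \<pi> ` {u \<in> {1..m}. adj n D w u}"
  proof (intro equalityI subsetI)
    fix u assume u: "u \<in> {u \<in> {1..m}. adj n ((`) \<pi> \<circ> D) (\<pi> w) u}"
    obtain v where v: "u = \<pi> v"
      using permutes_surj[OF assms] by (metis surjD)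
    then show "u \<in> \<pi> ` {u \<in> {1..m}. adj n D w u}"
      using u permutes_in_image[OF assms, of v] adj_image[OF inj] by auto
  next
    fix u assume "u \<in> \<pi> ` {u \<in> {1..m}. adj n D w u}"
    then show "u \<in> {u \<in> {1..m}. adj n ((`) \<pi> \<circ> D) (\<pi> w) u}"
      using permutes_in_image[OF assms] adj_image[OF inj] by blast
  qed
  then show ?thesis
    unfolding deg_def using inj by (simp add: card_image inj_on_subset)
qed

lemma ex_permutes_fix_1:
  fixes u v m :: nat
  assumes "u \<in> {2..m}" "v \<in> {2..m}" "u \<noteq> v"
  shows "\<exists>\<pi>. \<pi> permutes {1..m} \<and> \<pi> 1 = 1 \<and> \<pi> 2 = u \<and> \<pi> 3 = v"
proof -
  define \<tau> where "\<tau> = Transposition.transpose 2 u"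
  \<comment> \<open>First 2 is sent to \<open>u\<close>, then the image \<open>\<tau> 3\<close> of 3
    (which is 2 if \<open>u = 3\<close>) to \<open>v\<close>. Neither \<open>\<tau> 3\<close> nor
    \<open>v\<close> equals \<open>u\<close>, so the second transposition leaves \<open>u\<close> in
    place.\<close>
  define \<sigma> where "\<sigma> = Transposition.transpose (\<tau> 3) v"
  have m: "3 \<le> m"
    using assms by auto
  have \<tau>: "\<tau> permutes {1..m}"
    unfolding \<tau>_def using assms by (intro permutes_swap_id) auto
  have \<tau>3: "\<tau> 3 \<in> {2..m}" "\<tau> 3 \<noteq> u"
    using assms m by (auto simp: \<tau>_def Transposition.transpose_def)
  then have "\<sigma> permutes {1..m}"
    unfolding \<sigma>_def using assms by (intro permutes_swap_id) auto
  then have "\<sigma> \<circ> \<tau> permutes {1..m}"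
    using \<tau> by (intro permutes_compose)
  moreover have "(\<sigma> \<circ> \<tau>) 1 = 1" "(\<sigma> \<circ> \<tau>) 2 = u"
    using assms \<tau>3 by (auto simp: \<sigma>_def Transposition.transpose_def) (auto simp: \<tau>_def Transposition.transpose_def)
  moreover have "(\<sigma> \<circ> \<tau>) 3 = v"
    by (simp add: \<sigma>_def)
  ultimately show ?thesis
    by blast
qed

context
  fixes n m :: nat and P :: "nat pmf"
  assumes P: "set_pmf P \<subseteq> {..m}"
begin

text \<open>Every ordered pair of distinct attributes other than 1 is the image of (2, 3) under a
  permutation fixing 1, so all (m - 1)(m - 2) pairs have the same probability; these add up to the
  expected count.\<close>

lemma prob_pair_symmetric:
  fixes R :: "(nat \<Rightarrow> nat set) \<Rightarrow> nat \<Rightarrow> nat \<Rightarrow> bool"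
  assumes R: "\<And>\<pi> D u v. \<lbrakk>\<pi> permutes {1..m}; \<pi> 1 = 1\<rbrakk> \<Longrightarrow> R ((`) \<pi> \<circ> D) (\<pi> u) (\<pi> v) \<longleftrightarrow> R D u v"
  shows "real ((m - 1) * (m - 2)) * measure_pmf.prob (passive_rig n m P) {D. R D 2 3}
    = measure_pmf.expectation (passive_rig n m P)
        (\<lambda>D. real (card {(u, v). u \<in> {2..m} \<and> v \<in> {2..m} \<and> u \<noteq> v \<and> R D u v}))"
proof -
  let ?p = "passive_rig n m P"
  define I where "I = {(u, v). u \<in> {2..m} \<and> v \<in> {2..m} \<and> u \<noteq> v}"
  have fin: "finite I"
    unfolding I_def by (rule finite_subset[of _ "{2..m} \<times> {2..m}"]) auto
  have card_I: "card I = (m - 1) * (m - 2)"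
    unfolding I_def using card_off_diagonal[of "{2..m}"] by (simp add: numeral_2_eq_2)
  have sym: "measure_pmf.prob ?p {D. R D u v} = measure_pmf.prob ?p {D. R D 2 3}" if uv: "(u, v) \<in> I" for u v
  proof -
    obtain \<pi> where \<pi>: "\<pi> permutes {1..m}" "\<pi> 1 = 1" "\<pi> 2 = u" "\<pi> 3 = v"
      using ex_permutes_fix_1[of u m v] uv by (auto simp: I_def)
    have "measure_pmf.prob ?p {D. R D u v} = measure_pmf.prob (map_pmf (\<lambda>D. (`) \<pi> \<circ> D) ?p) {D. R D u v}"
      by (simp only: map_image_passive_rig[OF P \<pi>(1)])
    also have "\<dots> = measure_pmf.prob ?p {D. R ((`) \<pi> \<circ> D) (\<pi> 2) (\<pi> 3)}"
      unfolding measure_map_pmf vimage_def \<pi> by simp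
    finally show ?thesis
      using R[OF \<pi>(1,2)] by simp
  qed
  have "real (card {(u, v). u \<in> {2..m} \<and> v \<in> {2..m} \<and> u \<noteq> v \<and> R D u v})
      = (\<Sum>(u, v)\<in>I. indicator {D. R D u v} D)" for D
  proof -
    have "{(u, v). u \<in> {2..m} \<and> v \<in> {2..m} \<and> u \<noteq> v \<and> R D u v} = {x \<in> I. case x of (u, v) \<Rightarrow> R D u v}"
      by (auto simp: I_def)
    also have "real (card \<dots>) = (\<Sum>x\<in>I. if (case x of (u, v) \<Rightarrow> R D u v) then 1 else 0)"
      using fin by (simp add: sum.If_cases Int_def)
    finally show ?thesis
      by (auto simp: indicator_def intro!: sum.cong)
  qed
  then have "measure_pmf.expectation ?p (\<lambda>D. real (card {(u, v). u \<in> {2..m} \<and> v \<in> {2..m} \<and> u \<noteq> v \<and> R D u v}))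
      = measure_pmf.expectation ?p (\<lambda>D. \<Sum>x\<in>I. indicator {D. R D (fst x) (snd x)} D)"
    by (simp add: case_prod_beta)
  also have "\<dots> = (\<Sum>x\<in>I. measure_pmf.prob ?p {D. R D (fst x) (snd x)})"
    by (subst Bochner_Integration.integral_sum) (auto simp: measure_pmf.emeasure_eq_measure)
  also have "\<dots> = (\<Sum>x\<in>I. measure_pmf.prob ?p {D. R D 2 3})"
    using sym by (intro sum.cong) auto
  also have "\<dots> = real ((m - 1) * (m - 2)) * measure_pmf.prob ?p {D. R D 2 3}"
    by (simp add: card_I)
  finally show ?thesis ..
qed

text \<open>Apply the symmetry to the conditioning event \<open>R1\<close> and to the joint event
  \<open>R2\<close>. When the degree is \<open>k\<close>, the count for \<open>R1\<close> is k (k -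
  1) and the count for \<open>R2\<close> is \<open>T\<close>; the number of pairs cancels, being
  positive for m \<ge> 3.\<close>

lemma alpha_star_eq:
  assumes "m \<ge> 3"
  shows "alpha_star k n m P
    = measure_pmf.expectation (passive_rig n m P)
        (\<lambda>D. real (card (adjacent_nbr_pairs n D 1)) * indicator {D. card (nbrs n D 1) = k} D)
      / (real k * (real k - 1) * measure_pmf.prob (passive_rig n m P) {D. card (nbrs n D 1) = k})"
proof -
  let ?p = "passive_rig n m P"
  define c where "c = real ((m - 1) * (m - 2))"
  have c: "c > 0"
    using assms by (simp add: c_def)
  define R1 where "R1 D u v \<longleftrightarrow> adj n D 1 u \<and> adj n D 1 v \<and> deg n m D 1 = k" for D u v
  define R2 where "R2 D u v \<longleftrightarrow> adj n D u v \<and> adj n D 1 u \<and> adj n D 1 v \<and> deg n m D 1 = k" for D u v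
  have inv: "adj n ((`) \<pi> \<circ> D) 1 (\<pi> v) = adj n D 1 v" "deg n m ((`) \<pi> \<circ> D) 1 = deg n m D 1"
    "adj n ((`) \<pi> \<circ> D) (\<pi> u) (\<pi> v) = adj n D u v"
    if "\<pi> permutes {1..m}" "\<pi> 1 = 1" for \<pi> D u v
    using adj_image[OF permutes_inj[OF that(1)], of n D 1 v] adj_image[OF permutes_inj[OF that(1)], of n D u v]
      deg_image[OF that(1), of n D 1] that(2) by simp_all
  have "c * measure_pmf.prob ?p {D. R1 D 2 3} = measure_pmf.expectation ?p
      (\<lambda>D. real (card {(u, v). u \<in> {2..m} \<and> v \<in> {2..m} \<and> u \<noteq> v \<and> R1 D u v}))"
    unfolding c_def by (rule prob_pair_symmetric) (simp only: R1_def inv)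
  also have "\<dots> = measure_pmf.expectation ?p (\<lambda>D. real k * (real k - 1) * indicator {D. card (nbrs n D 1) = k} D)"
  proof (intro integral_cong_AE AE_pmfI)
    fix D assume D: "D \<in> set_pmf ?p"
    have fin: "finite (nbrs n D 1)"
      using nbrs_subset[OF P D] finite_subset by blast
    show "real (card {(u, v). u \<in> {2..m} \<and> v \<in> {2..m} \<and> u \<noteq> v \<and> R1 D u v})
      = real k * (real k - 1) * indicator {D. card (nbrs n D 1) = k} D"
    proof (cases "card (nbrs n D 1) = k")
      case True
      then have "{(u, v). u \<in> {2..m} \<and> v \<in> {2..m} \<and> u \<noteq> v \<and> R1 D u v}
          = {(u, v). u \<in> nbrs n D 1 \<and> v \<in> nbrs n D 1 \<and> u \<noteq> v}"
        using nbrs_subset[OF P D] deg_eq_card_nbrs[OF P D] by (auto simp: R1_def adj_iff_nbrs)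
      then have "card {(u, v). u \<in> {2..m} \<and> v \<in> {2..m} \<and> u \<noteq> v \<and> R1 D u v} = k * (k - 1)"
        using card_off_diagonal[OF fin] True by (simp only:)
      then show ?thesis
        using True by (cases k) (simp_all add: algebra_simps)
    next
      case False
      then show ?thesis
        using deg_eq_card_nbrs[OF P D] by (simp add: R1_def)
    qed
  qed auto
  finally have E1: "c * measure_pmf.prob ?p {D. R1 D 2 3}
      = real k * (real k - 1) * measure_pmf.prob ?p {D. card (nbrs n D 1) = k}"
    by simp
  have "c * measure_pmf.prob ?p {D. R2 D 2 3} = measure_pmf.expectation ?p
      (\<lambda>D. real (card {(u, v). u \<in> {2..m} \<and> v \<in> {2..m} \<and> u \<noteq> v \<and> R2 D u v}))"
    unfolding c_def by (rule prob_pair_symmetric) (simp only: R2_def inv)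
  also have "\<dots> = measure_pmf.expectation ?p
      (\<lambda>D. real (card (adjacent_nbr_pairs n D 1)) * indicator {D. card (nbrs n D 1) = k} D)"
  proof (intro integral_cong_AE AE_pmfI)
    fix D assume D: "D \<in> set_pmf ?p"
    show "real (card {(u, v). u \<in> {2..m} \<and> v \<in> {2..m} \<and> u \<noteq> v \<and> R2 D u v})
      = real (card (adjacent_nbr_pairs n D 1)) * indicator {D. card (nbrs n D 1) = k} D"
    proof (cases "card (nbrs n D 1) = k")
      case True
      have "u \<noteq> v" if "adj n D u v" for u v
        using that by (simp add: adj_def)
      then have "{(u, v). u \<in> {2..m} \<and> v \<in> {2..m} \<and> u \<noteq> v \<and> R2 D u v} = adjacent_nbr_pairs n D 1"
        using True nbrs_subset[OF P D] deg_eq_card_nbrs[OF P D]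
        by (auto simp: R2_def adj_iff_nbrs[of n D "Suc 0"] adjacent_nbr_pairs_def)
      then show ?thesis
        using True by simp
    next
      case False
      then show ?thesis
        using deg_eq_card_nbrs[OF P D] by (simp add: R2_def)
    qed
  qed auto
  finally have E2: "c * measure_pmf.prob ?p {D. R2 D 2 3} = measure_pmf.expectation ?p
      (\<lambda>D. real (card (adjacent_nbr_pairs n D 1)) * indicator {D. card (nbrs n D 1) = k} D)" .
  have "alpha_star k n m P = measure_pmf.prob ?p {D. R2 D 2 3} / measure_pmf.prob ?p {D. R1 D 2 3}"
    by (simp add: alpha_star_def cond_prob_def R1_def R2_def)
  also have "\<dots> = (c * measure_pmf.prob ?p {D. R2 D 2 3}) / (c * measure_pmf.prob ?p {D. R1 D 2 3})"
    using c by simp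
  finally show ?thesis
    unfolding E1 E2 .
qed

section \<open>Replacing degree and adjacent pairs by independent sums\<close>

lemma prob_others_card:
  "measure_pmf.prob (passive_rig n m P) {D. \<forall>j\<in>{1..n}. card (others 1 (D j)) = y j}
    = (\<Prod>j\<in>{1..n}. fps_nth (others_fps m P) (y j))"
  using prob_Pi_pmf_Ball[of "{1..n}" "{1..n}" "{}" _ "\<lambda>j. {A. card (others 1 A) = y j}"]
  by (simp add: passive_rig_def others_fps_def)

lemma prob_sum_others:
  "measure_pmf.prob (passive_rig n m P) {D. (\<Sum>j=1..n. card (others 1 (D j))) = l}
    = fps_nth (others_fps m P ^ n) l"
  using measure_pmf.prob_sum_eq_fps_power[of "{1..n}" "\<lambda>j D. card (others 1 (D j))" "passive_rig n m P" UNIV 1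
    "others_fps m P" l] prob_others_card by simp

lemma expectation_sum_others:
  "measure_pmf.expectation (passive_rig n m P)
      (\<lambda>D. real (\<Sum>j=1..n. card (others 1 (D j)) * (card (others 1 (D j)) - 1))
        * indicator {D. (\<Sum>j=1..n. card (others 1 (D j))) = l} D)
    = real n * (\<Sum>i\<le>l. real (i * (i - 1)) * fps_nth (others_fps m P) i
        * fps_nth (others_fps m P ^ (n - 1)) (l - i))"
proof -
  let ?p = "passive_rig n m P"
  define g where "g i = real (i * (i - 1))" for i :: nat
  define S where "S = {D :: nat \<Rightarrow> nat set. (\<Sum>j=1..n. card (others 1 (D j))) = l}"
  have "finite (set_pmf ?p)"
    unfolding passive_rig_def set_Pi_pmf[OF finite_atLeastAtMost]
    using set_random_subset_pmf[OF P] by (intro finite_PiE_dflt) (auto intro: finite_subset)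
  note int = integrable_measure_pmf_finite[OF this]
  have "measure_pmf.expectation ?p (\<lambda>D. real (\<Sum>j=1..n. card (others 1 (D j)) * (card (others 1 (D j)) - 1)) * indicator S D)
      = measure_pmf.expectation ?p (\<lambda>D. \<Sum>j=1..n. g (card (others 1 (D j))) * indicator S D)"
    by (simp add: g_def sum_distrib_right)
  also have "\<dots> = (\<Sum>j=1..n. measure_pmf.expectation ?p (\<lambda>D. g (card (others 1 (D j))) * indicator S D))"
    by (rule Bochner_Integration.integral_sum) (rule int)
  also have "\<dots> = (\<Sum>j=1..n. \<Sum>i\<le>l. g i * fps_nth (others_fps m P) i * fps_nth (others_fps m P ^ (n - 1)) (l - i))"
  proof (rule sum.cong)
    fix j assume "j \<in> {1..n}"
    then show "measure_pmf.expectation ?p (\<lambda>D. g (card (others 1 (D j))) * indicator S D)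
        = (\<Sum>i\<le>l. g i * fps_nth (others_fps m P) i * fps_nth (others_fps m P ^ (n - 1)) (l - i))"
      using measure_pmf.expectation_weighted_sum_eq[of "{1..n}" j "\<lambda>j D. card (others 1 (D j))" ?p UNIV 1
        "others_fps m P" g l] prob_others_card
      by (simp add: S_def)
  qed simp
  finally show ?thesis
    by (simp add: g_def S_def)
qed

text \<open>The two integrands agree outside the exceptional events and lie between 0 and k^2 on the
  support: \<open>T\<close> is at most the squared degree, and the sum of (Y_j)_2 is at most
  \<open>k\<close> times the sum of the Y_j.\<close>

lemma expectation_comparison:
  "\<bar>measure_pmf.expectation (passive_rig n m P)
        (\<lambda>D. real (card (adjacent_nbr_pairs n D 1)) * indicator {D. card (nbrs n D 1) = k} D)
    - measure_pmf.expectation (passive_rig n m P)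
      (\<lambda>D. real (\<Sum>j=1..n. card (others 1 (D j)) * (card (others 1 (D j)) - 1))
        * indicator {D. (\<Sum>j=1..n. card (others 1 (D j))) = k} D)\<bar>
    \<le> (real k)\<^sup>2 * measure_pmf.prob (passive_rig n m P) (overlap n m \<union> extra_edge n m)"
  and prob_comparison:
  "\<bar>measure_pmf.prob (passive_rig n m P) {D. card (nbrs n D 1) = k}
    - measure_pmf.prob (passive_rig n m P) {D. (\<Sum>j=1..n. card (others 1 (D j))) = k}\<bar>
    \<le> measure_pmf.prob (passive_rig n m P) (overlap n m \<union> extra_edge n m)"
proof -
  let ?p = "passive_rig n m P" and ?B = "overlap n m \<union> extra_edge n m"
  define f1 where "f1 D = real (card (adjacent_nbr_pairs n D 1)) * indicator {D. card (nbrs n D 1) = k} D" for D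
  define f2 where "f2 D = real (\<Sum>j=1..n. card (others 1 (D j)) * (card (others 1 (D j)) - 1))
        * indicator {D. (\<Sum>j=1..n. card (others 1 (D j))) = k} D" for D
  have "finite (set_pmf ?p)"
    unfolding passive_rig_def set_Pi_pmf[OF finite_atLeastAtMost]
    using set_random_subset_pmf[OF P] by (intro finite_PiE_dflt) (auto intro: finite_subset)
  note int = integrable_measure_pmf_finite[OF this]
  have f1: "0 \<le> f1 D \<and> f1 D \<le> (real k)\<^sup>2" if "D \<in> set_pmf ?p" for D
  proof (cases "card (nbrs n D 1) = k")
    case True
    then have "card (adjacent_nbr_pairs n D 1) \<le> k\<^sup>2"
      using card_adjacent_nbr_pairs_le[OF P that] by simp
    then have "real (card (adjacent_nbr_pairs n D 1)) \<le> (real k)\<^sup>2"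
      by (metis of_nat_le_iff of_nat_power)
    then show ?thesis
      using True by (simp add: f1_def)
  qed (simp add: f1_def)
  have f2: "0 \<le> f2 D \<and> f2 D \<le> (real k)\<^sup>2" for D
  proof (cases "(\<Sum>j=1..n. card (others 1 (D j))) = k")
    case True
    have "(\<Sum>j=1..n. card (others 1 (D j)) * (card (others 1 (D j)) - 1)) \<le> (\<Sum>j=1..n. card (others 1 (D j)) * k)"
    proof (rule sum_mono)
      fix j assume "j \<in> {1..n}"
      then have "card (others 1 (D j)) \<le> k"
        using True member_le_sum[of j "{1..n}" "\<lambda>j. card (others 1 (D j))"] by simp
      then show "card (others 1 (D j)) * (card (others 1 (D j)) - 1) \<le> card (others 1 (D j)) * k"
        by (intro mult_left_mono) auto
    qed
    also have "\<dots> = k\<^sup>2"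
      using True by (simp add: power2_eq_square flip: sum_distrib_right)
    finally have "real (\<Sum>j=1..n. card (others 1 (D j)) * (card (others 1 (D j)) - 1)) \<le> (real k)\<^sup>2"
      by (metis of_nat_le_iff of_nat_power)
    then show ?thesis
      using True by (auto simp: f2_def intro!: sum_nonneg)
  qed (simp add: f2_def)
  have "\<bar>f1 D - f2 D\<bar> \<le> (real k)\<^sup>2 * indicator ?B D" if D: "D \<in> set_pmf ?p" for D
  proof (cases "D \<in> ?B")
    case True
    then show ?thesis
      using f1[OF D] f2[of D] by (simp add: abs_le_iff)
  next
    case False
    then have "f1 D = f2 D"
      using card_nbrs_no_overlap[OF P D] card_adjacent_nbr_pairs_no_overlap[OF P D]
      by (simp add: f1_def f2_def indicator_def)
    then show ?thesis
      by simp
  qed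
  then have "measure_pmf.expectation ?p (\<lambda>D. \<bar>f1 D - f2 D\<bar>)
      \<le> measure_pmf.expectation ?p (\<lambda>D. (real k)\<^sup>2 * indicator ?B D)"
    by (intro integral_mono_AE int AE_pmfI)
  moreover have "\<bar>measure_pmf.expectation ?p f1 - measure_pmf.expectation ?p f2\<bar>
      \<le> measure_pmf.expectation ?p (\<lambda>D. \<bar>f1 D - f2 D\<bar>)"
    using integral_abs_bound[of ?p "\<lambda>D. f1 D - f2 D"] by (simp add: Bochner_Integration.integral_diff[OF int int])
  ultimately show "\<bar>measure_pmf.expectation ?p
        (\<lambda>D. real (card (adjacent_nbr_pairs n D 1)) * indicator {D. card (nbrs n D 1) = k} D)
    - measure_pmf.expectation ?p
      (\<lambda>D. real (\<Sum>j=1..n. card (others 1 (D j)) * (card (others 1 (D j)) - 1))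
        * indicator {D. (\<Sum>j=1..n. card (others 1 (D j))) = k} D)\<bar>
    \<le> (real k)\<^sup>2 * measure_pmf.prob ?p ?B"
    by (simp add: f1_def[abs_def] f2_def[abs_def])
  have eq: "D \<in> {D. card (nbrs n D 1) = k} \<longleftrightarrow> D \<in> {D. (\<Sum>j=1..n. card (others 1 (D j))) = k}"
    if "D \<in> set_pmf ?p" "D \<notin> ?B" for D
    using card_nbrs_no_overlap[OF P that(1)] that(2) by simp
  have le: "measure_pmf.prob ?p A \<le> measure_pmf.prob ?p A' + measure_pmf.prob ?p ?B"
    if "\<And>D. D \<in> set_pmf ?p \<Longrightarrow> D \<in> A \<Longrightarrow> D \<in> A' \<or> D \<in> ?B" for A A'
  proof -
    have "measure_pmf.prob ?p A \<le> measure_pmf.prob ?p (A' \<union> ?B)"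
      using that by (intro measure_pmf.finite_measure_mono_AE AE_pmfI) auto
    also have "\<dots> \<le> measure_pmf.prob ?p A' + measure_pmf.prob ?p ?B"
      by (intro measure_Un_le) auto
    finally show ?thesis .
  qed
  show "\<bar>measure_pmf.prob ?p {D. card (nbrs n D 1) = k}
    - measure_pmf.prob ?p {D. (\<Sum>j=1..n. card (others 1 (D j))) = k}\<bar> \<le> measure_pmf.prob ?p ?B"
    using le[of "{D. card (nbrs n D 1) = k}" "{D. (\<Sum>j=1..n. card (others 1 (D j))) = k}"]
      le[of "{D. (\<Sum>j=1..n. card (others 1 (D j))) = k}" "{D. card (nbrs n D 1) = k}"] eq
    by fastforce
qed

end

section \<open>Convergence of the law of the set sizes\<close>

text \<open>The limiting distribution function is constant between consecutive integers, hence
  continuous at half-integers, and a point mass is the difference of its values at two neighbouring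
  half-integers.\<close>

lemma tendsto_pmf_of_weak_conv:
  fixes P :: "nat \<Rightarrow> nat pmf" and Z :: "'b \<Rightarrow> nat"
  assumes "prob_space N" and [measurable]: "Z \<in> measurable N (count_space UNIV)"
    and conv: "weak_conv_m (\<lambda>m. distr (measure_pmf (P m)) borel real) (distr N borel (\<lambda>\<omega>. real (Z \<omega>)))"
  shows "(\<lambda>m. pmf (P m) i) \<longlonglongrightarrow> \<P>(\<omega> in N. Z \<omega> = i)"
proof -
  interpret N: prob_space N by fact
  define F where "F = cdf (distr N borel (\<lambda>\<omega>. real (Z \<omega>)))"
  have F: "F x = measure N {\<omega> \<in> space N. real (Z \<omega>) \<le> x}" for x
  proof -
    have "(\<lambda>\<omega>. real (Z \<omega>)) \<in> borel_measurable N"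
      by measurable
    then show ?thesis
      unfolding F_def cdf_def by (subst measure_distr) (auto intro!: arg_cong[where f = "measure N"])
  qed
  have cdf_P: "cdf (distr (measure_pmf (P m)) borel real) x = measure_pmf.prob (P m) {j. real j \<le> x}" for m x
    unfolding cdf_def by (subst measure_distr) (auto simp: vimage_def)
  \<comment> \<open>Here \<open>c\<close> is an integer rather than a natural number, so that
    \<open>c = -1\<close> serves for the mass at 0.\<close>
  have half: "(\<lambda>m. measure_pmf.prob (P m) {j. real j \<le> of_int c + 1 / 2}) \<longlonglongrightarrow>
      measure N {\<omega> \<in> space N. real (Z \<omega>) \<le> of_int c + 1 / 2}" for c :: int
  proof -
    have le_iff: "real j \<le> y \<longleftrightarrow> int j \<le> c" if "of_int c < y" "y < of_int c + 1" for j y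
    proof
      assume "real j \<le> y"
      then have "real_of_int (int j) < real_of_int (c + 1)"
        using that by simp
      then show "int j \<le> c"
        by (simp only: of_int_less_iff)
    next
      assume "int j \<le> c"
      then have "real_of_int (int j) \<le> real_of_int c"
        by (simp only: of_int_le_iff)
      then show "real j \<le> y"
        using that by simp
    qed
    have "F y = F (of_int c + 1 / 2)" if "y \<in> {of_int c<..<of_int c + 1}" for y
      unfolding F using that le_iff[of y] le_iff[of "of_int c + 1 / 2"] by simp
    then have "eventually (\<lambda>y. F y = F (of_int c + 1 / 2)) (nhds (of_int c + 1 / 2))"
    proof (rule eventually_mono[rotated])
      show "eventually (\<lambda>y. y \<in> {of_int c<..<of_int c + 1}) (nhds (of_int c + 1 / 2 :: real))"
        by (rule eventually_nhds_in_open) simp_all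
    qed
    then have "isCont F (of_int c + 1 / 2) \<longleftrightarrow> isCont (\<lambda>_. F (of_int c + 1 / 2)) (of_int c + 1 / 2 :: real)"
      by (rule isCont_cong)
    then have "isCont F (of_int c + 1 / 2)"
      by simp
    then have "(\<lambda>m. cdf (distr (measure_pmf (P m)) borel real) (of_int c + 1 / 2)) \<longlonglongrightarrow> F (of_int c + 1 / 2)"
      using conv unfolding weak_conv_m_def weak_conv_def F_def[symmetric] by (elim allE impE)
    then show ?thesis
      unfolding cdf_P F .
  qed
  have "(\<lambda>m. measure_pmf.prob (P m) {j. real j \<le> of_int (int i) + 1 / 2}
        - measure_pmf.prob (P m) {j. real j \<le> of_int (int i - 1) + 1 / 2})
      \<longlonglongrightarrow> measure N {\<omega> \<in> space N. real (Z \<omega>) \<le> of_int (int i) + 1 / 2}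
        - measure N {\<omega> \<in> space N. real (Z \<omega>) \<le> of_int (int i - 1) + 1 / 2}"
    by (intro tendsto_diff half)
  moreover have "measure_pmf.prob (P m) {j. real j \<le> of_int (int i) + 1 / 2}
        - measure_pmf.prob (P m) {j. real j \<le> of_int (int i - 1) + 1 / 2} = pmf (P m) i" for m
  proof -
    have "measure_pmf.prob (P m) {j. real j \<le> of_int (int i) + 1 / 2}
        - measure_pmf.prob (P m) {j. real j \<le> of_int (int i - 1) + 1 / 2}
        = measure_pmf.prob (P m) ({j. real j \<le> of_int (int i) + 1 / 2} - {j. real j \<le> of_int (int i - 1) + 1 / 2})"
      by (rule measure_pmf.finite_measure_Diff[symmetric]) auto
    also have "{j. real j \<le> of_int (int i) + 1 / 2} - {j. real j \<le> of_int (int i - 1) + 1 / 2} = {i}"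
      by auto
    finally show ?thesis
      by (simp add: measure_pmf_single)
  qed
  moreover have "measure N {\<omega> \<in> space N. real (Z \<omega>) \<le> of_int (int i) + 1 / 2}
        - measure N {\<omega> \<in> space N. real (Z \<omega>) \<le> of_int (int i - 1) + 1 / 2} = \<P>(\<omega> in N. Z \<omega> = i)"
  proof -
    have "measure N {\<omega> \<in> space N. real (Z \<omega>) \<le> of_int (int i) + 1 / 2}
        - measure N {\<omega> \<in> space N. real (Z \<omega>) \<le> of_int (int i - 1) + 1 / 2}
        = measure N ({\<omega> \<in> space N. real (Z \<omega>) \<le> of_int (int i) + 1 / 2}
            - {\<omega> \<in> space N. real (Z \<omega>) \<le> of_int (int i - 1) + 1 / 2})"
      by (rule N.finite_measure_Diff[symmetric]) (measurable, auto)
    also have "{\<omega> \<in> space N. real (Z \<omega>) \<le> of_int (int i) + 1 / 2}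
            - {\<omega> \<in> space N. real (Z \<omega>) \<le> of_int (int i - 1) + 1 / 2} = {\<omega> \<in> space N. Z \<omega> = i}"
      by auto
    finally show ?thesis .
  qed
  ultimately show ?thesis
    by (simp only:)
qed

text \<open>On \<open>Z > K\<close> one has Z^2 \<ge> K, hence Z \<le> Z^3 / K. The truncation error
  thus depends on the law only through the third moment.\<close>

lemma (in prob_space)
  fixes Z :: "'a \<Rightarrow> nat"
  assumes Z[measurable]: "Z \<in> measurable M (count_space UNIV)"
    and int3: "integrable M (\<lambda>\<omega>. real (Z \<omega>) ^ 3)"
  shows integrable_of_cube: "integrable M (\<lambda>\<omega>. real (Z \<omega>))"
    and expectation_truncation_le: "K \<ge> 1 \<Longrightarrow>
      \<bar>expectation (\<lambda>\<omega>. real (Z \<omega>)) - (\<Sum>i\<le>K. real i * prob {\<omega> \<in> space M. Z \<omega> = i})\<bar>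
        \<le> expectation (\<lambda>\<omega>. real (Z \<omega>) ^ 3) / real K"
proof -
  show int: "integrable M (\<lambda>\<omega>. real (Z \<omega>))"
  proof (rule Bochner_Integration.integrable_bound[OF int3])
    show "AE \<omega> in M. norm (real (Z \<omega>)) \<le> norm (real (Z \<omega>) ^ 3)"
    proof (rule AE_I2)
      fix \<omega>
      show "norm (real (Z \<omega>)) \<le> norm (real (Z \<omega>) ^ 3)"
        by (cases "Z \<omega> = 0") (auto intro!: self_le_power)
    qed
  qed measurable
  assume K: "K \<ge> 1"
  have split: "real (Z \<omega>) = real (Z \<omega>) * indicator {\<omega> \<in> space M. K < Z \<omega>} \<omega>
      + (\<Sum>i\<le>K. real i * indicator {\<omega> \<in> space M. Z \<omega> = i} \<omega>)" if "\<omega> \<in> space M" for \<omega>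
  proof (cases "Z \<omega> \<le> K")
    case True
    then have "(\<Sum>i\<le>K. real i * indicator {\<omega> \<in> space M. Z \<omega> = i} \<omega>)
        = (\<Sum>i\<in>{Z \<omega>}. real i * indicator {\<omega> \<in> space M. Z \<omega> = i} \<omega>)"
      by (intro sum.mono_neutral_right) auto
    then show ?thesis
      using True that by simp
  next
    case False
    then have "(\<Sum>i\<le>K. real i * indicator {\<omega> \<in> space M. Z \<omega> = i} \<omega>) = (0 :: real)"
      by (intro sum.neutral) auto
    then show ?thesis
      using False that by simp
  qed
  have int_tail: "integrable M (\<lambda>\<omega>. real (Z \<omega>) * indicator {\<omega> \<in> space M. K < Z \<omega>} \<omega>)"
    by (rule Bochner_Integration.integrable_bound[OF int]) (auto simp: indicator_def)
  have "expectation (\<lambda>\<omega>. real (Z \<omega>)) = expectation (\<lambda>\<omega>. real (Z \<omega>) * indicator {\<omega> \<in> space M. K < Z \<omega>} \<omega>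
      + (\<Sum>i\<le>K. real i * indicator {\<omega> \<in> space M. Z \<omega> = i} \<omega>))"
    using split by (intro Bochner_Integration.integral_cong) auto
  also have "\<dots> = expectation (\<lambda>\<omega>. real (Z \<omega>) * indicator {\<omega> \<in> space M. K < Z \<omega>} \<omega>)
      + expectation (\<lambda>\<omega>. \<Sum>i\<le>K. real i * indicator {\<omega> \<in> space M. Z \<omega> = i} \<omega>)"
    by (intro Bochner_Integration.integral_add int_tail Bochner_Integration.integrable_sum)
      (auto simp: emeasure_eq_measure)
  also have "expectation (\<lambda>\<omega>. \<Sum>i\<le>K. real i * indicator {\<omega> \<in> space M. Z \<omega> = i} \<omega>)
      = (\<Sum>i\<le>K. real i * prob {\<omega> \<in> space M. Z \<omega> = i})"
  proof -
    have "{\<omega> \<in> space M. Z \<omega> = i} \<inter> space M = {\<omega> \<in> space M. Z \<omega> = i}" for i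
      by auto
    then show ?thesis
      by (subst Bochner_Integration.integral_sum) (auto simp: emeasure_eq_measure)
  qed
  finally have eq: "expectation (\<lambda>\<omega>. real (Z \<omega>)) - (\<Sum>i\<le>K. real i * prob {\<omega> \<in> space M. Z \<omega> = i})
      = expectation (\<lambda>\<omega>. real (Z \<omega>) * indicator {\<omega> \<in> space M. K < Z \<omega>} \<omega>)"
    by simp
  have "expectation (\<lambda>\<omega>. real (Z \<omega>) * indicator {\<omega> \<in> space M. K < Z \<omega>} \<omega>)
      \<le> expectation (\<lambda>\<omega>. real (Z \<omega>) ^ 3 / real K)"
  proof (intro integral_mono int_tail)
    show "integrable M (\<lambda>\<omega>. real (Z \<omega>) ^ 3 / real K)"
      using int3 by simp
    fix \<omega>
    show "real (Z \<omega>) * indicator {\<omega> \<in> space M. K < Z \<omega>} \<omega> \<le> real (Z \<omega>) ^ 3 / real K"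
    proof (cases "K < Z \<omega>")
      case True
      have "real K \<le> real (Z \<omega>) ^ 2"
        using True self_le_power[of "real (Z \<omega>)" 2] by simp
      then have "real K * real (Z \<omega>) \<le> real (Z \<omega>) ^ 2 * real (Z \<omega>)"
        by (intro mult_right_mono) auto
      then have "real (Z \<omega>) \<le> real (Z \<omega>) ^ 3 / real K"
        using K by (simp add: field_simps power2_eq_square power3_eq_cube)
      moreover have "real (Z \<omega>) * indicator {\<omega> \<in> space M. K < Z \<omega>} \<omega> \<le> real (Z \<omega>)"
        by (simp add: indicator_def)
      ultimately show ?thesis
        by linarith
    qed simp
  qed
  moreover have "0 \<le> expectation (\<lambda>\<omega>. real (Z \<omega>) * indicator {\<omega> \<in> space M. K < Z \<omega>} \<omega>)"
    by (intro integral_nonneg_AE) auto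
  ultimately show "\<bar>expectation (\<lambda>\<omega>. real (Z \<omega>)) - (\<Sum>i\<le>K. real i * prob {\<omega> \<in> space M. Z \<omega> = i})\<bar>
        \<le> expectation (\<lambda>\<omega>. real (Z \<omega>) ^ 3) / real K"
    unfolding eq by simp
qed

text \<open>Bounded third moments make the tail of the mean uniformly small in \<open>m\<close>; the
  truncated mean is a finite sum and converges term by term.\<close>

lemma tendsto_expectation_of_cubes:
  fixes P :: "nat \<Rightarrow> nat pmf" and Z :: "'b \<Rightarrow> nat"
  assumes "prob_space N" and Z: "Z \<in> measurable N (count_space UNIV)"
    and int: "integrable N (\<lambda>\<omega>. real (Z \<omega>) ^ 3)"
    and fin: "\<And>m. finite (set_pmf (P m))"
    and pmf: "\<And>i. (\<lambda>m. pmf (P m) i) \<longlonglongrightarrow> \<P>(\<omega> in N. Z \<omega> = i)"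
    and cubes: "convergent (\<lambda>m. measure_pmf.expectation (P m) (\<lambda>x. real x ^ 3))"
  shows "(\<lambda>m. measure_pmf.expectation (P m) real) \<longlonglongrightarrow> (\<integral>\<omega>. real (Z \<omega>) \<partial>N)"
proof (rule tendstoI)
  interpret N: prob_space N by fact
  fix e :: real assume e: "e > 0"
  have "Bseq (\<lambda>m. measure_pmf.expectation (P m) (\<lambda>x. real x ^ 3))"
    using cubes by (rule convergent_imp_Bseq)
  then obtain C where C: "C > 0" "\<And>m. norm (measure_pmf.expectation (P m) (\<lambda>x. real x ^ 3)) \<le> C"
    by (auto elim: BseqE)
  \<comment> \<open>\<open>C'\<close> dominates the sum of the third moments of \<open>P m\<close>
    and of \<open>Z\<close>, so for this \<open>K\<close> the two truncation errors together stay
    below e/2.\<close>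
  define C' where "C' = C + \<bar>\<integral>\<omega>. real (Z \<omega>) ^ 3 \<partial>N\<bar>"
  obtain K :: nat where K: "K > 2 * C' / e"
    using reals_Archimedean2 by blast
  have "C' > 0"
    unfolding C'_def using C(1) by (rule add_pos_nonneg) (rule abs_ge_zero)
  then have "real K > 0"
    using e by (intro order.strict_trans[OF _ K]) simp
  then have K1: "K \<ge> 1"
    by simp
  have CK: "C' / real K < e / 2"
    using K e \<open>real K > 0\<close> by (simp add: field_simps)
  have "(\<lambda>m. \<Sum>i\<le>K. real i * pmf (P m) i) \<longlonglongrightarrow> (\<Sum>i\<le>K. real i * \<P>(\<omega> in N. Z \<omega> = i))"
    by (intro tendsto_intros pmf)
  then have "eventually (\<lambda>m. dist (\<Sum>i\<le>K. real i * pmf (P m) i) (\<Sum>i\<le>K. real i * \<P>(\<omega> in N. Z \<omega> = i)) < e / 2) sequentially"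
    using e by (intro tendstoD) auto
  then show "eventually (\<lambda>m. dist (measure_pmf.expectation (P m) real) (\<integral>\<omega>. real (Z \<omega>) \<partial>N) < e) sequentially"
  proof eventually_elim
    case (elim m)
    have "\<bar>measure_pmf.expectation (P m) real - (\<Sum>i\<le>K. real i * pmf (P m) i)\<bar>
        \<le> measure_pmf.expectation (P m) (\<lambda>x. real x ^ 3) / real K"
      using measure_pmf.expectation_truncation_le[of "\<lambda>x. x" "P m" K] K1
        integrable_measure_pmf_finite[OF fin, of m "\<lambda>x. real x ^ 3"]
      by (simp add: measure_pmf_single)
    also have "\<dots> \<le> C / real K"
      using C(2)[of m] by (intro divide_right_mono) auto
    finally have 1: "\<bar>measure_pmf.expectation (P m) real - (\<Sum>i\<le>K. real i * pmf (P m) i)\<bar> \<le> C / real K" .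
    have 2: "\<bar>(\<integral>\<omega>. real (Z \<omega>) \<partial>N) - (\<Sum>i\<le>K. real i * \<P>(\<omega> in N. Z \<omega> = i))\<bar>
        \<le> \<bar>\<integral>\<omega>. real (Z \<omega>) ^ 3 \<partial>N\<bar> / real K"
      by (rule order.trans[OF N.expectation_truncation_le[OF Z int K1]]) (auto intro: divide_right_mono)
    have "C' / real K = C / real K + \<bar>\<integral>\<omega>. real (Z \<omega>) ^ 3 \<partial>N\<bar> / real K"
      by (simp add: C'_def add_divide_distrib)
    then show ?case
      using 1 2 elim CK unfolding dist_real_def by linarith
  qed
qed

section \<open>The limit\<close>

lemma tendsto_prob_overlap_extra_edge:
  fixes n :: "nat \<Rightarrow> nat" and P :: "nat \<Rightarrow> nat pmf"
  assumes P: "\<And>m. set_pmf (P m) \<subseteq> {..m}"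
    and nm: "(\<lambda>m. real (n m) / real m) \<longlonglongrightarrow> b"
    and cubes: "(\<lambda>m. measure_pmf.expectation (P m) (\<lambda>x. real x ^ 3)) \<longlonglongrightarrow> C3"
  shows "(\<lambda>m. measure_pmf.prob (passive_rig (n m) m (P m)) (overlap (n m) m \<union> extra_edge (n m) m)) \<longlonglongrightarrow> 0"
proof -
  define C where "C m = 27 * measure_pmf.expectation (P m) (\<lambda>x. real x ^ 3)" for m
  define r where "r m = real (n m) / real m" for m
  \<comment> \<open>The union bounds rewritten in the convergent quantities \<open>C m\<close> and
    \<open>r m\<close>, which exposes a factor 1/m in each term.\<close>
  define U where "U m = (C m)\<^sup>2 * (r m)\<^sup>2 * inverse (real m) + C m ^ 3 * r m ^ 3 * inverse (real m)
    + (C m)\<^sup>2 * (r m)\<^sup>2 * inverse (real m)" for m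
  have C: "C \<longlonglongrightarrow> 27 * C3"
    unfolding C_def[abs_def] by (intro tendsto_intros cubes)
  have r: "r \<longlonglongrightarrow> b"
    using nm by (simp add: r_def[abs_def])
  have "U \<longlonglongrightarrow> (27 * C3)\<^sup>2 * b\<^sup>2 * 0 + (27 * C3) ^ 3 * b ^ 3 * 0 + (27 * C3)\<^sup>2 * b\<^sup>2 * 0"
    unfolding U_def[abs_def] by (intro tendsto_intros C r lim_inverse_n)
  then have U: "U \<longlonglongrightarrow> 0"
    by simp
  show ?thesis
  proof (rule tendsto_sandwich[OF _ _ tendsto_const U])
    show "eventually (\<lambda>m. measure_pmf.prob (passive_rig (n m) m (P m)) (overlap (n m) m \<union> extra_edge (n m) m)
        \<le> U m) sequentially"
      using eventually_gt_at_top[of 0]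
    proof eventually_elim
      case (elim m)
      let ?p = "measure_pmf.prob (passive_rig (n m) m (P m))"
      have "?p (overlap (n m) m \<union> extra_edge (n m) m) \<le> ?p (overlap (n m) m) + ?p (extra_edge (n m) m)"
        by (intro measure_Un_le) auto
      also have "\<dots> \<le> real (n m) ^ 2 * real m * (C m / real m ^ 2) ^ 2 +
          (real (n m) ^ 3 * real m ^ 2 * (C m / real m ^ 2) ^ 3
            + real (n m) ^ 2 * real m ^ 2 * (C m / real m ^ 2 * (C m / real m ^ 3)))"
        unfolding C_def by (intro add_mono prob_overlap_le[OF P] prob_extra_edge_le[OF P])
      also have "\<dots> = U m"
        using elim by (simp add: U_def r_def field_simps power2_eq_square power3_eq_cube)
      finally show ?case .
    qed
  qed simp
qed

theorem theorem3p3: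
  fixes \<beta> :: real and n :: "nat \<Rightarrow> nat" and P :: "nat \<Rightarrow> nat pmf"
    and N :: "'b measure" and Z :: "'b \<Rightarrow> nat"
    and M :: "'a measure" and \<Lambda> :: "'a \<Rightarrow> nat" and Zt :: "nat \<Rightarrow> 'a \<Rightarrow> nat"
    and k :: nat
  assumes "\<beta> > 0"
    and "filterlim n at_top sequentially"
    and "(\<lambda>m. real m / real (n m)) \<longlonglongrightarrow> \<beta>"
    and "\<And>m. set_pmf (P m) \<subseteq> {0..m}"
    and "prob_space N" and "Z \<in> measurable N (count_space UNIV)"
    and "weak_conv_m (\<lambda>m. distr (measure_pmf (P m)) borel real)
           (distr N borel (\<lambda>\<omega>. real (Z \<omega>)))"
    and "integrable N (\<lambda>\<omega>. real (Z \<omega>) ^ 3)"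
    and "\<P>(\<omega> in N. Z \<omega> \<ge> 2) > 0"
    and "(\<lambda>m. measure_pmf.expectation (P m) (\<lambda>x. real x ^ 3))
           \<longlonglongrightarrow> (\<integral>\<omega>. real (Z \<omega>) ^ 3 \<partial>N)"
    and "prob_space M"
    and "\<And>j. j \<ge> 1 \<Longrightarrow>
           distributed M (count_space UNIV) (Zt j) (\<lambda>i. ennreal (size_biased_mass N Z i))"
    and "distr M (count_space UNIV) \<Lambda> = measure_pmf (poisson_pmf ((\<integral>\<omega>. real (Z \<omega>) \<partial>N) / \<beta>))"
    and "prob_space.indep_vars M (\<lambda>_. count_space UNIV) (\<lambda>j. if j = 0 then \<Lambda> else Zt j) UNIV"
    and "k \<ge> 2"
    and "\<P>(\<omega> in M. d_star \<Lambda> Zt \<omega> = k) > 0"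
  shows "(\<lambda>m. alpha_star k (n m) m (P m)
            - 1 / (real k * (real k - 1))
              * event_cond_exp M (d2_star \<Lambda> Zt) (\<lambda>\<omega>. d_star \<Lambda> Zt \<omega> = k)) \<longlonglongrightarrow> 0"
proof -

  \<comment> \<open>The limiting set-size law and its mean\<close>
  interpret N: prob_space N by fact
  interpret M: prob_space M by fact
  have P: "set_pmf (P m) \<subseteq> {..m}" for m
    using assms(4) by (simp add: atLeast0AtMost)
  have fin: "finite (set_pmf (P m))" for m
    using P finite_subset by blast
  note Z[measurable] = assms(6)
  define z where "z i = \<P>(\<omega> in N. Z \<omega> = i)" for i
  define \<mu> where "\<mu> = (\<integral>\<omega>. real (Z \<omega>) \<partial>N)"
  define \<theta> where "\<theta> = \<mu> / \<beta>"
  define p where "p i = size_biased_mass N Z i" for i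
  have p: "p i = real (i + 1) * z (i + 1) / \<mu>" for i
    by (simp add: p_def size_biased_mass_def z_def \<mu>_def)
  have \<mu>: "\<mu> > 0"
  proof -
    have "0 < \<P>(\<omega> in N. Z \<omega> \<ge> 2)"
      by fact
    also have "\<dots> = N.expectation (indicator {\<omega> \<in> space N. Z \<omega> \<ge> 2})"
      by (simp add: Int_def conj_commute)
    also have "\<dots> \<le> \<mu>"
      unfolding \<mu>_def
      by (intro integral_mono N.integrable_of_cube[OF Z assms(8)]) (auto simp: indicator_def N.emeasure_eq_measure)
    finally show ?thesis .
  qed
  then have \<theta>: "\<theta> > 0"
    using assms(1) by (simp add: \<theta>_def)
  have pmf_P: "(\<lambda>m. pmf (P m) i) \<longlonglongrightarrow> z i" for i
    unfolding z_def by (rule tendsto_pmf_of_weak_conv) fact+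
  have mean_P: "(\<lambda>m. measure_pmf.expectation (P m) real) \<longlonglongrightarrow> \<mu>"
    unfolding \<mu>_def using pmf_P assms(10)
    by (intro tendsto_expectation_of_cubes[OF assms(5,6,8) fin]) (auto simp: z_def convergent_def)

  \<comment> \<open>The limit variables as a compound Poisson sum\<close>
  interpret cp: compound_poisson M \<Lambda> Zt \<theta> p
  proof
    show indep: "M.indep_vars (\<lambda>_. count_space UNIV) (\<lambda>j. if j = 0 then \<Lambda> else Zt j) UNIV"
      by fact
    have [measurable]: "\<Lambda> \<in> measurable M (count_space UNIV)"
      using indep unfolding M.indep_vars_def2 by (metis UNIV_I)
    show "M.prob {\<omega> \<in> space M. \<Lambda> \<omega> = r} = \<theta> ^ r / fact r * exp (- \<theta>)" for r
    proof -
      have "M.prob {\<omega> \<in> space M. \<Lambda> \<omega> = r} = measure (distr M (count_space UNIV) \<Lambda>) {r}"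
        by (subst measure_distr) (auto intro!: arg_cong[where f = M.prob])
      also have "\<dots> = \<theta> ^ r / fact r * exp (- \<theta>)"
        using \<theta> unfolding assms(13) by (simp add: measure_pmf_single \<theta>_def \<mu>_def)
      finally show ?thesis .
    qed
    show "M.prob {\<omega> \<in> space M. Zt j \<omega> = i} = p i" if "j \<ge> 1" for j i
    proof -
      have "emeasure M (Zt j -` {i} \<inter> space M) = (\<integral>\<^sup>+x. ennreal (p x) * indicator {i} x \<partial>count_space UNIV)"
        unfolding p_def by (rule distributed_emeasure[OF assms(12)[OF that]]) simp
      also have "\<dots> = ennreal (p i)"
        by (subst nn_integral_indicator_singleton) auto
      also have "Zt j -` {i} \<inter> space M = {\<omega> \<in> space M. Zt j \<omega> = i}"
        by auto
      finally show ?thesis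
        using \<mu> by (simp add: measure_def p z_def)
    qed
  qed

  \<comment> \<open>Convergence of the coefficients\<close>
  define a where "a l = M.prob {\<omega> \<in> space M. d_star \<Lambda> Zt \<omega> = l}" for l
  define Q where "Q m = others_fps m (P m)" for m
  \<comment> \<open>The limit of n Q_i, where 1/\<beta> comes from n/m. The mean \<mu> cancels
    between \<theta> and the size-biased mass, so this is \<theta> p(i).\<close>
  define q where "q i = real (i + 1) * z (i + 1) / \<beta>" for i
  have q: "q i = \<theta> * p i" for i
    using \<mu> by (simp add: q_def p \<theta>_def)
  have "(\<lambda>m. inverse (real m / real (n m))) \<longlonglongrightarrow> inverse \<beta>"
    using assms(1,3) by (intro tendsto_inverse) auto
  then have nm: "(\<lambda>m. real (n m) / real m) \<longlonglongrightarrow> inverse \<beta>"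
    by (simp add: inverse_eq_divide)
  have Q0: "(\<lambda>m. real (n m) * (1 - fps_nth (Q m) 0)) \<longlonglongrightarrow> \<theta> * (1 - p 0)"
  proof (rule Lim_transform_eventually)
    \<comment> \<open>Both sides equal (\<mu> - z(1)) / \<beta>, the limit suggested by the formula
      for 1 - Q_0.\<close>
    have "\<theta> * (1 - p 0) = inverse \<beta> * (\<mu> - \<mu> * p 0)"
      by (simp add: \<theta>_def divide_inverse algebra_simps)
    moreover have "\<mu> * p 0 = z 1"
      using \<mu> by (simp add: p)
    ultimately show "(\<lambda>m. real (n m) / real m * (measure_pmf.expectation (P m) real - pmf (P m) 1)) \<longlonglongrightarrow> \<theta> * (1 - p 0)"
      using tendsto_mult[OF nm tendsto_diff[OF mean_P pmf_P[of 1]]] by simp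
    show "eventually (\<lambda>m. real (n m) / real m * (measure_pmf.expectation (P m) real - pmf (P m) 1)
        = real (n m) * (1 - fps_nth (Q m) 0)) sequentially"
      using eventually_ge_at_top[of 1]
    proof eventually_elim
      case (elim m)
      then show ?case
        unfolding Q_def others_fps_nth_0[OF P elim] by simp
    qed
  qed
  have Qi: "(\<lambda>m. real (n m) * fps_nth (Q m) i) \<longlonglongrightarrow> q i" if i: "i \<ge> 1" for i
  proof (rule Lim_transform_eventually)
    show "(\<lambda>m. real (n m) / real m * (real (i + 1) * pmf (P m) (i + 1))) \<longlonglongrightarrow> q i"
      using tendsto_mult[OF nm tendsto_mult[OF tendsto_const[of "real (i + 1)"] pmf_P[of "i + 1"]]]
      by (simp add: q_def field_simps)
    show "eventually (\<lambda>m. real (n m) / real m * (real (i + 1) * pmf (P m) (i + 1))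
        = real (n m) * fps_nth (Q m) i) sequentially"
      using eventually_ge_at_top[of 1]
    proof eventually_elim
      case (elim m)
      then show ?case
        unfolding Q_def others_fps_nth[OF P elim i] by simp
    qed
  qed
  have a0: "a 0 = exp (- (\<theta> * (1 - p 0)))"
    unfolding a_def by (rule cp.prob_d_star_0)
  have a_rec: "real l * a l = (\<Sum>i=1..l. real i * q i * a (l - i))" if "l \<ge> 1" for l
  proof -
    have "real l * a l = (\<Sum>i\<le>l. real i * q i * a (l - i))"
      using cp.prob_d_star_panjer[of l] by (simp add: a_def q sum_distrib_left mult_ac)
    also have "\<dots> = (\<Sum>i=1..l. real i * q i * a (l - i))"
      by (intro sum.mono_neutral_right) auto
    finally show ?thesis .
  qed
  have lim: "(\<lambda>m. fps_nth (Q m ^ n m) l) \<longlonglongrightarrow> a l" for l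
    by (rule tendsto_fps_power_nth[OF assms(2) Q0 Qi a0 a_rec])
  have lim_pred: "(\<lambda>m. fps_nth (Q m ^ (n m - 1)) l) \<longlonglongrightarrow> a l" for l
    \<comment> \<open>The exponent n - 1 arises because one summand is singled out in the weighted
      expectation; its coefficients have the same limits.\<close>
    by (rule tendsto_fps_power_nth[OF filterlim_pred[OF assms(2)] tendsto_pred_mult[OF assms(2) Q0]
          tendsto_pred_mult[OF assms(2) Qi] a0 a_rec])

  \<comment> \<open>The limiting numerator\<close>
  define L where "L = (\<Sum>i=1..k. real (i * (i - 1)) * q i * a (k - i))"
  have L: "M.expectation (\<lambda>\<omega>. d2_star \<Lambda> Zt \<omega> * indicator {\<omega> \<in> space M. d_star \<Lambda> Zt \<omega> = k} \<omega>) = L"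
  proof -
    \<comment> \<open>Truncated and real subtraction give the same product, the factor
      \<open>i\<close> vanishing when they differ.\<close>
    have g: "real (i * (i - 1)) = real i * (real i - 1)" for i
      by (cases i) (auto simp: algebra_simps)
    have "M.expectation (\<lambda>\<omega>. (\<Sum>j=1..\<Lambda> \<omega>. real (Zt j \<omega> * (Zt j \<omega> - 1)))
          * indicator {\<omega> \<in> space M. d_star \<Lambda> Zt \<omega> = k} \<omega>)
        = \<theta> * (\<Sum>i\<le>k. real (i * (i - 1)) * p i * a (k - i))"
      unfolding a_def
    proof (rule cp.expectation_d_star_panjer[where g = "\<lambda>i. real (i * (i - 1))"])
      show "real (i * (i - 1)) \<le> (real i)\<^sup>2" for i
        unfolding g power2_eq_square by (intro mult_left_mono) auto
    qed simp
    also have "\<dots> = (\<Sum>i\<le>k. real (i * (i - 1)) * q i * a (k - i))"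
      by (simp add: q sum_distrib_left mult_ac)
    also have "\<dots> = L"
      unfolding L_def by (intro sum.mono_neutral_right) auto
    finally show ?thesis
      by (simp only: d2_star_def g)
  qed

  \<comment> \<open>Comparison with the graph and conclusion\<close>
  define bad where "bad m = measure_pmf.prob (passive_rig (n m) m (P m)) (overlap (n m) m \<union> extra_edge (n m) m)" for m
  have bad: "bad \<longlonglongrightarrow> 0"
    unfolding bad_def[abs_def] by (rule tendsto_prob_overlap_extra_edge[OF P nm assms(10)])
  define A where "A m = measure_pmf.expectation (passive_rig (n m) m (P m))
    (\<lambda>D. real (card (adjacent_nbr_pairs (n m) D 1)) * indicator {D. card (nbrs (n m) D 1) = k} D)" for m
  define B where "B m = measure_pmf.prob (passive_rig (n m) m (P m)) {D. card (nbrs (n m) D 1) = k}" for m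
  define A' where "A' m = real (n m) * (\<Sum>i\<le>k. real (i * (i - 1)) * fps_nth (Q m) i
        * fps_nth (Q m ^ (n m - 1)) (k - i))" for m
  \<comment> \<open>Discarding \<open>i = 0\<close>, which has weight 0, matters for the limit: n
    Q_i converges for i \<ge> 1, whereas n Q_0 is unbounded.\<close>
  have "A' m = (\<Sum>i=1..k. real (i * (i - 1)) * (real (n m) * fps_nth (Q m) i) * fps_nth (Q m ^ (n m - 1)) (k - i))" for m
  proof -
    have "A' m = (\<Sum>i\<le>k. real (i * (i - 1)) * (real (n m) * fps_nth (Q m) i) * fps_nth (Q m ^ (n m - 1)) (k - i))"
      by (simp add: A'_def sum_distrib_left mult_ac)
    also have "\<dots> = (\<Sum>i=1..k. real (i * (i - 1)) * (real (n m) * fps_nth (Q m) i) * fps_nth (Q m ^ (n m - 1)) (k - i))"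
      by (intro sum.mono_neutral_right) auto
    finally show ?thesis .
  qed
  moreover have "(\<lambda>m. \<Sum>i=1..k. real (i * (i - 1)) * (real (n m) * fps_nth (Q m) i) * fps_nth (Q m ^ (n m - 1)) (k - i)) \<longlonglongrightarrow> L"
    unfolding L_def by (intro tendsto_intros lim_pred Qi) auto
  ultimately have A': "A' \<longlonglongrightarrow> L"
    by presburger
  have "(\<lambda>m. A m - A' m) \<longlonglongrightarrow> 0"
  proof (rule Lim_null_comparison)
    show "eventually (\<lambda>m. norm (A m - A' m) \<le> (real k)\<^sup>2 * bad m) sequentially"
      using expectation_comparison[OF P] expectation_sum_others[OF P]
      by (simp add: A_def A'_def Q_def bad_def)
    show "(\<lambda>m. (real k)\<^sup>2 * bad m) \<longlonglongrightarrow> 0"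
      using tendsto_mult[OF tendsto_const[of "(real k)\<^sup>2"] bad] by simp
  qed
  from tendsto_add[OF this A'] have A: "A \<longlonglongrightarrow> L"
    by simp
  have "(\<lambda>m. B m - fps_nth (Q m ^ n m) k) \<longlonglongrightarrow> 0"
  proof (rule Lim_null_comparison[OF _ bad])
    show "eventually (\<lambda>m. norm (B m - fps_nth (Q m ^ n m) k) \<le> bad m) sequentially"
      using prob_comparison[OF P] prob_sum_others[OF P]
      by (simp add: B_def Q_def bad_def)
  qed
  from tendsto_add[OF this lim[of k]] have B: "B \<longlonglongrightarrow> a k"
    by simp
  have ak: "a k > 0"
    using assms(16) by (simp add: a_def)
  \<comment> \<open>The denominator has a nonzero limit because \<open>k \<ge> 2\<close> and the
    event \<open>d_star = k\<close> has positive probability.\<close>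
  have "(\<lambda>m. A m / (real k * (real k - 1) * B m)) \<longlonglongrightarrow> L / (real k * (real k - 1) * a k)"
    using ak assms(15) by (intro tendsto_intros A B) auto
  moreover have "eventually (\<lambda>m. A m / (real k * (real k - 1) * B m) = alpha_star k (n m) m (P m)) sequentially"
    using eventually_ge_at_top[of 3]
    by eventually_elim (simp add: alpha_star_eq[OF P] A_def B_def)
  ultimately have "(\<lambda>m. alpha_star k (n m) m (P m)) \<longlonglongrightarrow> L / (real k * (real k - 1) * a k)"
    by (rule Lim_transform_eventually)
  moreover have "1 / (real k * (real k - 1)) * event_cond_exp M (d2_star \<Lambda> Zt) (\<lambda>\<omega>. d_star \<Lambda> Zt \<omega> = k)
      = L / (real k * (real k - 1) * a k)"
    by (simp add: event_cond_exp_def L a_def)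
  ultimately show ?thesis
    by (simp add: LIM_zero)
qed

end
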